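(* Let $X$ be a proper metric space and $n\ge 0$. Then $\dim^c X\le n$ if and only if $\dim\nu X\le n$ (covering dimension of the Higson corona).
   Context: A metric space is proper if every closed ball is compact. A map $f:(X,d_X)\to(Y,d_Y)$ is asymptotically Lipschitz if there are $\lambda,s\ge0$ with $d_Y(f(x),f(x'))\le\lambda d_X(x,x')+s$ for all $x,x'$. A map is proper if preimages of compact sets are compact. By definition $\dim^cX\le n$ means: for every closed subset $A\subset X$ (with the induced metric) and every continuous proper asymptotically Lipschitz map $f:A\to\mathbb R^{n+1}$ (Euclidean metric) there exists a continuous proper asymptotically Lipschitz map $\bar f:X\to\mathbb R^{n+1}$ with $\bar f|_A=f$. For a proper metric space $X$, a bounded continuous $f:X\to\mathbb R$ is a Higson function if for every $R>0$, $\mathrm{Var}_Rf(x)=\sup_{y\in B_R(x)}|f(x)-f(y)|\to0$ as $x\to\infty$; the Higson compactification $\bar X$ is the closure of the image of $X$ under $x\mapsto(f(x))_{f}$ in $\mathbb R^{C_h(X)}$, $C_h(X)$ the set of Higson functions, and the Higson corona is $\nu X=\bar X\setminus X$. *)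

theory Defs
  imports "HOL-Analysis.Analysis"
begin

definition proper_metric_space :: "'a::metric_space itself \<Rightarrow> bool" where
  "proper_metric_space _ \<longleftrightarrow> (\<forall>(x::'a) r. compact (cball x r))"

definition asymp_lipschitz_on :: "'a::metric_space set \<Rightarrow> ('a \<Rightarrow> 'b::metric_space) \<Rightarrow> bool" where
  "asymp_lipschitz_on A f \<longleftrightarrow>
     (\<exists>L s. L \<ge> 0 \<and> s \<ge> 0 \<and>
        (\<forall>x\<in>A. \<forall>x'\<in>A. dist (f x) (f x') \<le> L * dist x x' + s))"

definition proper_map_on :: "'a::topological_space set \<Rightarrow> ('a \<Rightarrow> 'b::topological_space) \<Rightarrow> bool" where
  "proper_map_on A f \<longleftrightarrow> (\<forall>K. compact K \<longrightarrow> compact {x\<in>A. f x \<in> K})"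

text \<open>dim^c X \<le> n, where the type 'n has n+1 elements, i.e. real^'n is R^(n+1).\<close>
definition dimc_le :: "'a::metric_space itself \<Rightarrow> 'n::finite itself \<Rightarrow> bool" where
  "dimc_le _ _ \<longleftrightarrow>
     (\<forall>(A::'a set) (f::'a \<Rightarrow> real^'n).
        closed A \<and> continuous_on A f \<and> proper_map_on A f \<and> asymp_lipschitz_on A f \<longrightarrow>
        (\<exists>g::'a \<Rightarrow> real^'n. continuous_on UNIV g \<and> proper_map_on UNIV g \<and>
            asymp_lipschitz_on UNIV g \<and> (\<forall>x\<in>A. g x = f x)))"

definition higson_function :: "('a::metric_space \<Rightarrow> real) \<Rightarrow> bool" where
  "higson_function f \<longleftrightarrow> bounded (range f) \<and> continuous_on UNIV f \<and>
     (\<forall>R>0. \<forall>e>0. \<exists>K. compact K \<and>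
        (\<forall>x. x \<notin> K \<longrightarrow> (SUP y\<in>ball x R. \<bar>f x - f y\<bar>) < e))"

definition higson_functions :: "('a::metric_space \<Rightarrow> real) set" where
  "higson_functions = {f. higson_function f}"

definition higson_embedding :: "'a::metric_space \<Rightarrow> (('a \<Rightarrow> real) \<Rightarrow> real)" where
  "higson_embedding x = restrict (\<lambda>f. f x) higson_functions"

definition higson_product :: "(('a::metric_space \<Rightarrow> real) \<Rightarrow> real) topology" where
  "higson_product = product_topology (\<lambda>_. euclideanreal) higson_functions"

definition higson_compactification :: "'a::metric_space itself \<Rightarrow> (('a \<Rightarrow> real) \<Rightarrow> real) set" where
  "higson_compactification _ = higson_product closure_of (range (higson_embedding :: 'a \<Rightarrow> _))"

definition higson_corona :: "'a::metric_space itself \<Rightarrow> (('a \<Rightarrow> real) \<Rightarrow> real) topology" where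
  "higson_corona T = subtopology higson_product
      (higson_compactification T - range (higson_embedding :: 'a \<Rightarrow> _))"

definition covering_dim_le :: "'a topology \<Rightarrow> nat \<Rightarrow> bool" where
  "covering_dim_le X n \<longleftrightarrow>
     (\<forall>\<U>. finite \<U> \<and> (\<forall>U\<in>\<U>. openin X U) \<and> topspace X \<subseteq> \<Union>\<U> \<longrightarrow>
       (\<exists>\<V>. finite \<V> \<and> (\<forall>V\<in>\<V>. openin X V) \<and> topspace X \<subseteq> \<Union>\<V> \<and>
            (\<forall>V\<in>\<V>. \<exists>U\<in>\<U>. V \<subseteq> U) \<and>
            (\<forall>x\<in>topspace X. card {V\<in>\<V>. x \<in> V} \<le> n + 1)))"

end

theory Submission
  imports Defs
begin

text \<open>Both conditions are equivalent to an extension property on the space itself: every bounded,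
  continuous, slowly oscillating \<open>F : X \<rightarrow> \<real>^(n+1)\<close> admits a slowly oscillating \<open>G\<close> which, outside a bounded
  set, has norm 1 and equals \<open>F / |F|\<close> where \<open>|F| \<ge> 1\<close>.

  On the metric side, a slowly oscillating sphere-valued map becomes a proper asymptotically Lipschitz
  map after multiplication by a sufficiently slowly growing function, and a proper asymptotically
  Lipschitz map oscillates slowly after radial projection. On the corona side, a point of the corona is
  a filter at infinity along which all Higson functions converge, so finite open covers of the corona
  are the same thing as finite families of nonnegative Higson functions whose sum is bounded below near
  infinity; the equivalence of covering dimension and extension of maps to spheres can then be carried
  out with such functions, without extending functions from the corona.\<close>

section \<open>Slowly oscillating maps\<close>

text \<open>Radial projection forgets the radius, and restoring it is the obstacle. A sphere-valued
  slow map \<open>G\<close> oscillates at no prescribed rate, so scaling it by the full length of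
  the map to be extended may destroy the asymptotic Lipschitz bound. Only a factor adapted to
  \<open>G\<close> is safe, and it may grow far more slowly than the given map. The missing length
  is therefore put on the original direction field, a quotient of Lipschitz functions whose
  oscillation decays like the reciprocal of its denominator. Errors on bounded sets are harmless: a
  bounded continuous correction preserves properness and the asymptotic Lipschitz condition, and the
  corona does not see bounded sets at all.\<close>

text \<open>\<open>undefined\<close> serves as an arbitrary base point. In a bounded space this
  filter is \<open>bot\<close>, so bounded spaces are covered without a case distinction.\<close>

definition away :: "'a::metric_space filter" where
  "away = filtercomap (dist undefined) at_top"

lemma eventually_away:
  "(\<forall>\<^sub>F x in away. P x) \<longleftrightarrow> (\<exists>r. \<forall>x. r < dist undefined x \<longrightarrow> P x)"
  unfolding away_def eventually_filtercomap_at_top_dense by blast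

lemma filterlim_dist_away: "filterlim (dist undefined) at_top away"
  unfolding away_def by (rule filterlim_filtercomap)

lemma proper_metric_spaceD:
  assumes "proper_metric_space TYPE('a::metric_space)"
    and "closed S" and "bounded (S :: 'a set)"
  shows "compact S"
proof -
  obtain x r where "S \<subseteq> cball x r"
    using \<open>bounded S\<close> unfolding bounded_def subset_iff mem_cball by blast
  then show ?thesis
    using assms compact_Int_closed[of "cball x r" S]
    unfolding proper_metric_space_def by (metis Int_absorb1)
qed

text \<open>The Higson condition for metric targets, with bounded sets in place of compact ones and
  a pointwise bound in place of the supremum. A radius \<open>R \<le> 0\<close> adds only a vacuous
  condition.\<close>

definition slow_map :: "('a::metric_space \<Rightarrow> 'b::metric_space) \<Rightarrow> bool" where
  "slow_map f \<longleftrightarrow> bounded (range f) \<and> continuous_on UNIV f \<and>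
     (\<forall>R. \<forall>e>0. \<forall>\<^sub>F x in away. \<forall>y. dist x y < R \<longrightarrow> dist (f x) (f y) < e)"

lemma slow_map_bounded: "slow_map f \<Longrightarrow> bounded (range f)"
  and slow_map_continuous: "slow_map f \<Longrightarrow> continuous_on UNIV f"
  by (auto simp: slow_map_def)

lemma slow_mapD:
  "slow_map f \<Longrightarrow> 0 < e \<Longrightarrow> \<forall>\<^sub>F x in away. \<forall>y. dist x y < R \<longrightarrow> dist (f x) (f y) < e"
  by (simp add: slow_map_def)

lemma slow_map_normD:
  fixes f :: "'a::metric_space \<Rightarrow> 'b::real_normed_vector"
  assumes "slow_map f"
  obtains B where "0 < B" "\<And>x. norm (f x) \<le> B"
  using slow_map_bounded[OF assms] bounded_pos[of "range f"] by auto

section \<open>Closure properties of slow maps\<close>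

text \<open>The range has compact closure because the target is Heine-Borel, so a merely continuous
  \<open>\<Phi>\<close> is uniformly continuous where it matters. Together with pairing this yields
  the whole calculus of slow maps.\<close>

lemma slow_map_compose:
  fixes f :: "'a::metric_space \<Rightarrow> 'b::heine_borel" and \<Phi> :: "'b \<Rightarrow> 'c::metric_space"
  assumes f: "slow_map f" and \<Phi>: "continuous_on UNIV \<Phi>"
  shows "slow_map (\<lambda>x. \<Phi> (f x))"
proof -
  let ?K = "closure (range f)"
  have K: "compact ?K"
    using slow_map_bounded[OF f] by (simp add: compact_closure)
  have inK: "f x \<in> ?K" for x
    by (meson closure_subset rangeI subsetD)
  have cont: "continuous_on ?K \<Phi>"
    using \<Phi> continuous_on_subset by blast
  then have uc: "uniformly_continuous_on ?K \<Phi>"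
    using K by (rule compact_uniformly_continuous)
  show ?thesis
    unfolding slow_map_def
  proof (intro conjI allI impI)
    have "bounded (\<Phi> ` ?K)"
      using compact_continuous_image[OF cont K] compact_imp_bounded by blast
    then show "bounded (range (\<lambda>x. \<Phi> (f x)))"
      by (rule bounded_subset) (use inK in blast)
    show "continuous_on UNIV (\<lambda>x. \<Phi> (f x))"
      using continuous_on_compose2[OF \<Phi> slow_map_continuous[OF f]] by simp
    fix R e :: real assume "0 < e"
    then obtain d where "0 < d" and d: "\<forall>u\<in>?K. \<forall>v\<in>?K. dist v u < d \<longrightarrow> dist (\<Phi> v) (\<Phi> u) < e"
      using uc unfolding uniformly_continuous_on_def by metis
    show "\<forall>\<^sub>F x in away. \<forall>y. dist x y < R \<longrightarrow> dist (\<Phi> (f x)) (\<Phi> (f y)) < e"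
      using slow_mapD[OF f \<open>0 < d\<close>, of R] by eventually_elim (use d inK in blast)
  qed
qed

lemma slow_map_Pair:
  fixes f :: "'a::metric_space \<Rightarrow> 'b::metric_space" and g :: "'a \<Rightarrow> 'c::metric_space"
  assumes f: "slow_map f" and g: "slow_map g"
  shows "slow_map (\<lambda>x. (f x, g x))"
  unfolding slow_map_def
proof (intro conjI allI impI)
  show "bounded (range (\<lambda>x. (f x, g x)))"
    by (rule bounded_subset[OF bounded_Times[OF slow_map_bounded[OF f] slow_map_bounded[OF g]]]) auto
  show "continuous_on UNIV (\<lambda>x. (f x, g x))"
    using f g by (intro continuous_on_Pair slow_map_continuous)
  fix R e :: real assume "0 < e"
  then have "0 < e / 2" by simp
  show "\<forall>\<^sub>F x in away. \<forall>y. dist x y < R \<longrightarrow> dist (f x, g x) (f y, g y) < e"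
    using slow_mapD[OF f \<open>0 < e / 2\<close>, of R] slow_mapD[OF g \<open>0 < e / 2\<close>, of R]
  proof eventually_elim
    case (elim x)
    show ?case
    proof (intro allI impI)
      fix y assume "dist x y < R"
      with elim have "dist (f x) (f y) + dist (g x) (g y) < e" by fastforce
      then show "dist (f x, g x) (f y, g y) < e"
        unfolding dist_Pair_Pair
        using sqrt_sum_squares_le_sum[of "dist (f x) (f y)" "dist (g x) (g y)"] by simp
    qed
  qed
qed

lemma slow_map_const: "slow_map (\<lambda>_. c)"
  by (simp add: slow_map_def)

lemma slow_map_binary:
  fixes f :: "'a::metric_space \<Rightarrow> 'b::heine_borel" and g :: "'a \<Rightarrow> 'c::heine_borel"
    and \<Phi> :: "'b \<times> 'c \<Rightarrow> 'd::metric_space"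
  assumes "slow_map f" "slow_map g" "continuous_on UNIV \<Phi>"
  shows "slow_map (\<lambda>x. \<Phi> (f x, g x))"
  using slow_map_compose[OF slow_map_Pair[OF assms(1,2)] assms(3)] .

lemma slow_map_add:
  fixes f g :: "'a::metric_space \<Rightarrow> 'b::euclidean_space"
  assumes "slow_map f" "slow_map g"
  shows "slow_map (\<lambda>x. f x + g x)"
  using slow_map_binary[OF assms, of "\<lambda>z. fst z + snd z"] by (simp add: continuous_intros)

lemma slow_map_diff:
  fixes f g :: "'a::metric_space \<Rightarrow> 'b::euclidean_space"
  assumes "slow_map f" "slow_map g"
  shows "slow_map (\<lambda>x. f x - g x)"
  using slow_map_binary[OF assms, of "\<lambda>z. fst z - snd z"] by (simp add: continuous_intros)

lemma slow_map_scaleR: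
  fixes f :: "'a::metric_space \<Rightarrow> real" and g :: "'a \<Rightarrow> 'b::euclidean_space"
  assumes "slow_map f" "slow_map g"
  shows "slow_map (\<lambda>x. f x *\<^sub>R g x)"
  using slow_map_binary[OF assms, of "\<lambda>z. fst z *\<^sub>R snd z"] by (simp add: continuous_intros)

lemma slow_map_max:
  fixes f g :: "'a::metric_space \<Rightarrow> real"
  assumes "slow_map f" "slow_map g"
  shows "slow_map (\<lambda>x. max (f x) (g x))"
  using slow_map_binary[OF assms, of "\<lambda>z. max (fst z) (snd z)"] by (simp add: continuous_intros)

lemma slow_map_min:
  fixes f g :: "'a::metric_space \<Rightarrow> real"
  assumes "slow_map f" "slow_map g"
  shows "slow_map (\<lambda>x. min (f x) (g x))"
  using slow_map_binary[OF assms, of "\<lambda>z. min (fst z) (snd z)"] by (simp add: continuous_intros)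

lemma slow_map_abs:
  fixes f :: "'a::metric_space \<Rightarrow> real"
  assumes "slow_map f"
  shows "slow_map (\<lambda>x. \<bar>f x\<bar>)"
  using slow_map_compose[OF assms, of abs] by (simp add: continuous_intros)

lemma slow_map_norm:
  fixes f :: "'a::metric_space \<Rightarrow> 'b::euclidean_space"
  assumes "slow_map f"
  shows "slow_map (\<lambda>x. norm (f x))"
  using slow_map_compose[OF assms, of norm] by (simp add: continuous_intros)

lemma slow_map_component:
  fixes f :: "'a::metric_space \<Rightarrow> real^'n"
  assumes "slow_map f"
  shows "slow_map (\<lambda>x. f x $ i)"
  using slow_map_compose[OF assms, of "\<lambda>z. z $ i"] by (simp add: continuous_intros)

lemma slow_map_sum:
  fixes f :: "'i \<Rightarrow> 'a::metric_space \<Rightarrow> 'b::euclidean_space"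
  assumes "\<And>i. i \<in> I \<Longrightarrow> slow_map (f i)"
  shows "slow_map (\<lambda>x. \<Sum>i\<in>I. f i x)"
  using assms
  by (induction I rule: infinite_finite_induct) (auto intro: slow_map_const slow_map_add)

lemma slow_map_vec:
  fixes f :: "'a::metric_space \<Rightarrow> real^'n"
  assumes "\<And>i. slow_map (\<lambda>x. f x $ i)"
  shows "slow_map f"
proof -
  have "f x = (\<Sum>i\<in>UNIV. (f x $ i) *\<^sub>R axis i 1)" for x
    by (simp add: vec_eq_iff axis_def if_distrib cong: if_cong)
  moreover have "slow_map (\<lambda>x. \<Sum>i\<in>UNIV. (f x $ i) *\<^sub>R (axis i 1 :: real^'n))"
    by (intro slow_map_sum slow_map_scaleR assms slow_map_const)
  ultimately show ?thesis
    by (metis (no_types, lifting) ext)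
qed

text \<open>Inversion becomes continuous on the whole line once the denominator is floored at
  \<open>c\<close>. In the applications \<open>c \<le> h x\<close> holds where the exact quotient
  matters.\<close>

lemma slow_map_divide_max:
  fixes f :: "'a::metric_space \<Rightarrow> 'b::euclidean_space"
  assumes "slow_map f" "slow_map h" "0 < c"
  shows "slow_map (\<lambda>x. f x /\<^sub>R max c (h x))"
proof -
  have "slow_map (\<lambda>x. inverse (max c (h x)))"
    using assms slow_map_compose[of h "\<lambda>t. inverse (max c t)"]
    by (force intro!: continuous_intros)
  then show ?thesis
    using assms by (intro slow_map_scaleR)
qed

lemma higson_function_iff_slow_map:
  fixes f :: "'a::metric_space \<Rightarrow> real"
  assumes X: "proper_metric_space TYPE('a)"
  shows "higson_function f \<longleftrightarrow> slow_map f"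
proof -
  have "(\<forall>R>0. \<forall>e>0. \<exists>K. compact K \<and> (\<forall>x. x \<notin> K \<longrightarrow> (SUP y\<in>ball x R. \<bar>f x - f y\<bar>) < e))
      \<longleftrightarrow> (\<forall>R. \<forall>e>0. \<forall>\<^sub>F x in away. \<forall>y. dist x y < R \<longrightarrow> dist (f x) (f y) < e)"
    (is "?L \<longleftrightarrow> ?R") if bdd: "bounded (range f)"
  proof
    obtain B where B: "\<And>x. \<bar>f x\<bar> \<le> B"
      using bdd by (auto simp: bounded_iff)
    assume L: ?L
    show ?R
    proof (intro allI impI)
      fix R e :: real assume "0 < e"
      \<comment> \<open>Higson functions are tested on positive radii only, so the radius is
        enlarged.\<close>
      have "0 < max R 1" by simp
      then obtain K where "compact K"
        and K: "\<And>x. x \<notin> K \<Longrightarrow> (SUP y\<in>ball x (max R 1). \<bar>f x - f y\<bar>) < e"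
        using L \<open>0 < e\<close> by meson
      obtain r where r: "\<And>x. x \<in> K \<Longrightarrow> dist undefined x \<le> r"
        using compact_imp_bounded[OF \<open>compact K\<close>] bounded_any_center[of K undefined] by blast
      have "dist (f x) (f y) < e" if x: "r < dist undefined x" and y: "dist x y < R" for x y
      proof -
        have "bdd_above ((\<lambda>y. \<bar>f x - f y\<bar>) ` ball x (max R 1))"
          using B by (intro bdd_aboveI2[where M = "2 * B"]) (smt (verit))
        then have "\<bar>f x - f y\<bar> \<le> (SUP y\<in>ball x (max R 1). \<bar>f x - f y\<bar>)"
          using y by (intro cSUP_upper) auto
        then show ?thesis
          using K[of x] r[of x] x by (fastforce simp: dist_real_def)
      qed
      then show "\<forall>\<^sub>F x in away. \<forall>y. dist x y < R \<longrightarrow> dist (f x) (f y) < e"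
        unfolding eventually_away by blast
    qed
  next
    assume R: ?R
    show ?L
    proof (intro allI impI)
      fix R e :: real assume "0 < R" "0 < e"
      \<comment> \<open>Pointwise strict bounds survive a supremum only as a weak one;
        \<open>e / 2\<close> restores strictness.\<close>
      then obtain r
        where r: "\<And>x y. r < dist undefined x \<Longrightarrow> dist x y < R \<Longrightarrow> dist (f x) (f y) < e / 2"
        using R[rule_format, of "e / 2" R] unfolding eventually_away by auto
      have "(SUP y\<in>ball x R. \<bar>f x - f y\<bar>) < e" if "x \<notin> cball undefined r" for x
      proof -
        have "(SUP y\<in>ball x R. \<bar>f x - f y\<bar>) \<le> e / 2"
          using r[of x] that \<open>0 < R\<close> by (intro cSUP_least) (auto simp: dist_real_def less_imp_le)
        then show ?thesis using \<open>0 < e\<close> by simp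
      qed
      then show "\<exists>K. compact K \<and> (\<forall>x. x \<notin> K \<longrightarrow> (SUP y\<in>ball x R. \<bar>f x - f y\<bar>) < e)"
        using X unfolding proper_metric_space_def by blast
    qed
  qed
  then show ?thesis
    unfolding higson_function_def slow_map_def by (intro conj_cong refl)
qed

text \<open>This function separates the point \<open>z\<close> from everything at infinity, which
  keeps embedded points out of the corona.\<close>

lemma slow_map_bump:
  fixes z :: "'a::metric_space"
  shows "slow_map (\<lambda>x. max 0 (1 - dist z x))"
  unfolding slow_map_def
proof (intro conjI allI impI)
  show "bounded (range (\<lambda>x. max 0 (1 - dist z x)))"
    by (auto simp: bounded_iff intro!: exI[of _ 1])
  show "continuous_on UNIV (\<lambda>x. max 0 (1 - dist z x))"
    by (intro continuous_intros)
  fix R e :: real assume "0 < e"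
  have "max 0 (1 - dist z x) = 0 \<and> max 0 (1 - dist z y) = 0"
    if "1 + \<bar>R\<bar> + dist undefined z < dist undefined x" "dist x y < R" for x y
    using that dist_triangle[of undefined x z] dist_triangle[of z x y] by (simp add: dist_commute)
  then show "\<forall>\<^sub>F x in away. \<forall>y. dist x y < R \<longrightarrow> dist (max 0 (1 - dist z x)) (max 0 (1 - dist z y)) < e"
    using \<open>0 < e\<close> unfolding eventually_away by (metis dist_self)
qed

section \<open>Asymptotically Lipschitz maps\<close>

text \<open>Each \<open>a\<close> contributes an \<open>L\<close>-Lipschitz function of
  \<open>x\<close>, and infima preserve this; the bound \<open>b\<close> only keeps the infimum
  finite. No regularity of \<open>f\<close> enters, so the lemma serves both for McShane extension
  and for smoothing a step function.\<close>

lemma inf_convolution_lipschitz: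
  fixes f :: "'a::metric_space \<Rightarrow> real"
  assumes "A \<noteq> {}" "0 \<le> L" and b: "\<And>x a. a \<in> A \<Longrightarrow> b x \<le> f a + L * dist x a"
  shows "\<bar>(INF a\<in>A. f a + L * dist x a) - (INF a\<in>A. f a + L * dist y a)\<bar> \<le> L * dist x y"
proof -
  have "(INF a\<in>A. f a + L * dist x a) \<le> (INF a\<in>A. f a + L * dist y a) + L * dist x y" for x y
  proof -
    have "(INF a\<in>A. f a + L * dist x a) - L * dist x y \<le> f a + L * dist y a" if "a \<in> A" for a
    proof -
      have "(INF a\<in>A. f a + L * dist x a) \<le> f a + L * dist x a"
        using b that by (intro cINF_lower bdd_belowI2) auto
      moreover have "L * dist x a \<le> L * dist x y + L * dist y a"
        using mult_left_mono[OF dist_triangle[of x a y] \<open>0 \<le> L\<close>] by (simp add: algebra_simps)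
      ultimately show ?thesis by linarith
    qed
    then have "(INF a\<in>A. f a + L * dist x a) - L * dist x y \<le> (INF a\<in>A. f a + L * dist y a)"
      using \<open>A \<noteq> {}\<close> by (intro cINF_greatest)
    then show ?thesis by simp
  qed
  from this[of x y] this[of y x] show ?thesis by (simp add: dist_commute)
qed

text \<open>McShane's formula in each coordinate. The additive error \<open>s\<close> turns into a
  bounded discrepancy on \<open>A\<close>, and the factor \<open>CARD('n)\<close> comes from
  estimating the norm by the sum of the coordinates.\<close>

lemma asymp_lipschitz_on_near_lipschitz:
  fixes f :: "'a::metric_space \<Rightarrow> real^'n"
  assumes "asymp_lipschitz_on A f" "A \<noteq> {}"
  obtains g :: "'a \<Rightarrow> real^'n" and L C
  where "0 \<le> L" "0 \<le> C" "\<And>x y. norm (g x - g y) \<le> L * dist x y" "\<And>x. x \<in> A \<Longrightarrow> norm (g x - f x) \<le> C"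
proof -
  obtain L s where Ls: "0 \<le> L" "0 \<le> s"
    and f: "\<And>x y. x \<in> A \<Longrightarrow> y \<in> A \<Longrightarrow> dist (f x) (f y) \<le> L * dist x y + s"
    using assms unfolding asymp_lipschitz_on_def by blast
  obtain a0 where "a0 \<in> A" using \<open>A \<noteq> {}\<close> by blast
  have fi: "f y $ i - s \<le> f a $ i + L * dist y a" if "a \<in> A" "y \<in> A" for a y i
    using f[of y a] that component_le_norm_cart[of "f y - f a" i] by (simp add: dist_norm)
  have b: "f a0 $ i - s - L * dist a0 x \<le> f a $ i + L * dist x a" if "a \<in> A" for a x i
    using fi[OF that \<open>a0 \<in> A\<close>, of i] mult_left_mono[OF dist_triangle[of a0 a x] \<open>0 \<le> L\<close>]
    by (simp add: algebra_simps)
  define g :: "'a \<Rightarrow> real^'n" where "g x = (\<chi> i. INF a\<in>A. f a $ i + L * dist x a)" for x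
  show ?thesis
  proof
    show "0 \<le> real CARD('n) * L" "0 \<le> real CARD('n) * s" using Ls by auto
    fix x y
    have "norm (g x - g y) \<le> (\<Sum>i\<in>UNIV. \<bar>(g x - g y) $ i\<bar>)"
      by (rule norm_le_l1_cart)
    also have "\<dots> \<le> (\<Sum>i\<in>(UNIV::'n set). L * dist x y)"
      using inf_convolution_lipschitz[OF \<open>A \<noteq> {}\<close> \<open>0 \<le> L\<close> b]
      by (intro sum_mono) (simp add: g_def)
    finally show "norm (g x - g y) \<le> real CARD('n) * L * dist x y" by simp
  next
    fix x assume "x \<in> A"
    have "\<bar>(g x - f x) $ i\<bar> \<le> s" for i
    proof -
      have "(INF a\<in>A. f a $ i + L * dist x a) \<le> f x $ i + L * dist x x"
        using b \<open>x \<in> A\<close> by (intro cINF_lower bdd_belowI2) auto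
      moreover have "f x $ i - s \<le> (INF a\<in>A. f a $ i + L * dist x a)"
        using fi \<open>x \<in> A\<close> \<open>A \<noteq> {}\<close> by (intro cINF_greatest) auto
      ultimately show ?thesis
        using \<open>0 \<le> s\<close> by (simp add: g_def)
    qed
    then have "norm (g x - f x) \<le> (\<Sum>i\<in>(UNIV::'n set). s)"
      by (intro order_trans[OF norm_le_l1_cart] sum_mono)
    then show "norm (g x - f x) \<le> real CARD('n) * s" by simp
  qed
qed

section \<open>Slow maps obtained by radial scaling, and their converse\<close>

text \<open>After multiplication by \<open>d\<close> the difference is \<open>u - v\<close> plus
  \<open>(e - d) / e\<close> times \<open>v\<close>, and \<open>norm v \<le> e\<close> absorbs the
  quotient.\<close>

lemma norm_quotient_diff_le:
  fixes u v :: "'b::real_normed_vector"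
  assumes "norm v \<le> e" "0 < d" "0 < e"
  shows "d * norm (u /\<^sub>R d - v /\<^sub>R e) \<le> norm (u - v) + \<bar>d - e\<bar>"
proof -
  have "d * norm (u /\<^sub>R d - v /\<^sub>R e) = norm (d *\<^sub>R (u /\<^sub>R d - v /\<^sub>R e))"
    using \<open>0 < d\<close> by simp
  also have "d *\<^sub>R (u /\<^sub>R d - v /\<^sub>R e) = (u - v) + ((e - d) / e) *\<^sub>R v"
  proof -
    have "(e - d) / e = 1 - d / e" using \<open>0 < e\<close> by (simp add: diff_divide_distrib)
    then show ?thesis
      using \<open>0 < d\<close> by (simp add: scaleR_diff_right scaleR_left_diff_distrib divide_inverse[symmetric])
  qed
  also have "norm \<dots> \<le> norm (u - v) + \<bar>d - e\<bar> * (norm v / e)"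
    using norm_triangle_ineq[of "u - v" "((e - d) / e) *\<^sub>R v"] \<open>0 < e\<close>
    by (simp add: abs_minus_commute)
  also have "\<bar>d - e\<bar> * (norm v / e) \<le> \<bar>d - e\<bar> * 1"
    using assms by (intro mult_left_mono) auto
  finally show ?thesis by simp
qed

text \<open>Within distance \<open>R\<close>, \<open>u\<close> and \<open>D\<close> together change
  by at most a constant, so the quotient changes by at most that constant divided by
  \<open>D x\<close>.\<close>

lemma slow_map_quotient:
  fixes u :: "'a::metric_space \<Rightarrow> 'b::real_normed_vector" and D :: "'a \<Rightarrow> real"
  assumes u: "continuous_on UNIV u" "asymp_lipschitz_on UNIV u"
    and D: "continuous_on UNIV D" "asymp_lipschitz_on UNIV D" "filterlim D at_top away"
    and uD: "\<And>x. norm (u x) \<le> D x" and pos: "\<And>x. 0 < D x"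
  shows "slow_map (\<lambda>x. u x /\<^sub>R D x)"
  unfolding slow_map_def
proof (intro conjI allI impI)
  show "bounded (range (\<lambda>x. u x /\<^sub>R D x))"
    unfolding bounded_iff using uD pos
    by (intro exI[of _ 1]) (auto simp: divide_simps abs_of_pos)
  show "continuous_on UNIV (\<lambda>x. u x /\<^sub>R D x)"
    using u D pos by (intro continuous_intros) (auto simp: less_imp_neq[symmetric])
  fix R e :: real assume "0 < e"
  obtain L s where L: "0 \<le> L" "0 \<le> s" "\<And>x y. norm (u x - u y) \<le> L * dist x y + s"
    using u(2) unfolding asymp_lipschitz_on_def dist_norm by auto
  obtain M t where M: "0 \<le> M" "0 \<le> t" "\<And>x y. \<bar>D x - D y\<bar> \<le> M * dist x y + t"
    using D(2) unfolding asymp_lipschitz_on_def dist_real_def by auto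
  define C where "C = (L * R + s) + (M * R + t)"
  have "\<forall>\<^sub>F x in away. C / e < D x"
    using D(3) by (simp add: filterlim_at_top_dense)
  then show "\<forall>\<^sub>F x in away. \<forall>y. dist x y < R \<longrightarrow> dist (u x /\<^sub>R D x) (u y /\<^sub>R D y) < e"
  proof eventually_elim
    case (elim x)
    show ?case
    proof (intro allI impI)
      fix y assume "dist x y < R"
      then have LM: "L * dist x y \<le> L * R" "M * dist x y \<le> M * R"
        using L(1) M(1) by (auto intro!: mult_left_mono)
      have "D x * norm (u x /\<^sub>R D x - u y /\<^sub>R D y) \<le> norm (u x - u y) + \<bar>D x - D y\<bar>"
        by (rule norm_quotient_diff_le[OF uD pos pos])
      also have "\<dots> \<le> C"
        using L(3)[of x y] M(3)[of x y] LM by (simp add: C_def)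
      also have "C < D x * e"
        using elim \<open>0 < e\<close> by (simp add: divide_simps)
      finally show "dist (u x /\<^sub>R D x) (u y /\<^sub>R D y) < e"
        using pos[of x] by (simp add: dist_norm)
    qed
  qed
qed

lemma asymp_lipschitz_on_lipschitz:
  "0 \<le> L \<Longrightarrow> (\<And>x y. x \<in> A \<Longrightarrow> y \<in> A \<Longrightarrow> dist (f x) (f y) \<le> L * dist x y) \<Longrightarrow> asymp_lipschitz_on A f"
  unfolding asymp_lipschitz_on_def by (intro exI[of _ L] exI[of _ 0]) auto

lemma asymp_lipschitz_on_add:
  fixes f g :: "'a::metric_space \<Rightarrow> 'b::real_normed_vector"
  assumes "asymp_lipschitz_on A f" "asymp_lipschitz_on A g"
  shows "asymp_lipschitz_on A (\<lambda>x. f x + g x)"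
proof -
  obtain L s M t where L: "0 \<le> L" "0 \<le> s" "0 \<le> M" "0 \<le> t"
    and f: "\<And>x y. x \<in> A \<Longrightarrow> y \<in> A \<Longrightarrow> dist (f x) (f y) \<le> L * dist x y + s"
    and g: "\<And>x y. x \<in> A \<Longrightarrow> y \<in> A \<Longrightarrow> dist (g x) (g y) \<le> M * dist x y + t"
    using assms unfolding asymp_lipschitz_on_def by metis
  have "dist (f x + g x) (f y + g y) \<le> (L + M) * dist x y + (s + t)" if "x \<in> A" "y \<in> A" for x y
    using f[OF that] g[OF that] dist_triangle_add[of "f x" "g x" "f y" "g y"]
    by (simp add: algebra_simps)
  then show ?thesis
    unfolding asymp_lipschitz_on_def using L by (intro exI[of _ "L + M"] exI[of _ "s + t"]) auto
qed

lemma asymp_lipschitz_on_bounded: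
  fixes f :: "'a::metric_space \<Rightarrow> 'b::real_normed_vector"
  assumes "\<And>x. x \<in> A \<Longrightarrow> norm (f x) \<le> C"
  shows "asymp_lipschitz_on A f"
proof -
  have "dist (f x) (f y) \<le> 0 * dist x y + 2 * \<bar>C\<bar>" if "x \<in> A" "y \<in> A" for x y
    using assms[OF that(1)] assms[OF that(2)] norm_triangle_ineq4[of "f x" "f y"]
    by (simp add: dist_norm)
  then show ?thesis
    unfolding asymp_lipschitz_on_def by (intro exI[of _ 0] exI[of _ "2 * \<bar>C\<bar>"]) auto
qed

lemma asymp_lipschitz_on_norm:
  fixes f :: "'a::metric_space \<Rightarrow> 'b::real_normed_vector"
  assumes "asymp_lipschitz_on A f"
  shows "asymp_lipschitz_on A (\<lambda>x. norm (f x))"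
  using assms unfolding asymp_lipschitz_on_def dist_norm real_norm_def
  by (meson norm_triangle_ineq3 order_trans)

lemma lipschitz_imp_continuous_on:
  fixes f :: "'a::metric_space \<Rightarrow> 'b::metric_space"
  assumes "\<And>x y. dist (f x) (f y) \<le> L * dist x y" "0 \<le> L"
  shows "continuous_on A f"
  by (rule lipschitz_on_continuous_on[of L]) (use assms in \<open>auto simp: lipschitz_on_def\<close>)

text \<open>The pointwise obstructions to growth are satisfied by any \<beta> that grows slowly enough;
  its infimal convolution with the metric is Lipschitz, lies below \<beta>, and still tends to infinity.\<close>

lemma slowly_growing_function:
  fixes \<psi> :: "'a::metric_space \<Rightarrow> 'b::real_normed_vector" and D :: "'a \<Rightarrow> real"
  assumes \<psi>: "slow_map \<psi>" and D: "filterlim D at_top away" "\<And>x. 0 \<le> D x"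
  obtains \<rho> :: "'a \<Rightarrow> real"
  where "\<And>x y. \<bar>\<rho> x - \<rho> y\<bar> \<le> dist x y" "\<And>x. 0 \<le> \<rho> x" "\<And>x. \<rho> x \<le> D x"
    "filterlim \<rho> at_top away" "asymp_lipschitz_on UNIV (\<lambda>x. \<rho> x *\<^sub>R \<psi> x)"
proof -
  obtain B where B: "0 < B" "\<And>x. norm (\<psi> x) \<le> B"
    using slow_map_normD[OF \<psi>] by blast
  have \<psi>B: "norm (\<psi> x - \<psi> y) \<le> 2 * B" for x y
    using B(2)[of x] B(2)[of y] norm_triangle_ineq4[of "\<psi> x" "\<psi> y"] by simp
  \<comment> \<open>The value \<open>k\<close> is admissible at \<open>x\<close> if it respects the
    ceiling \<open>D\<close> and if \<open>k\<close> times the oscillation of \<open>\<psi>\<close>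
    obeys the bound used at the end for the scaled map.\<close>
  define P where "P k x \<longleftrightarrow> k \<le> D x \<and> (\<forall>y. k * norm (\<psi> x - \<psi> y) \<le> 1 + 2 * B * dist x y)" for k :: real and x
  have "\<forall>\<^sub>F x in away. P (real k) x" for k
  proof -
    have "\<forall>\<^sub>F x in away. real k \<le> D x"
      using D(1) by (simp add: filterlim_at_top)
    \<comment> \<open>For \<open>y\<close> within distance \<open>k\<close>, slowness makes the
      product at most \<open>k / (1 + k)\<close>; for the others \<open>2 * B * dist x y\<close>
      already dominates. The \<open>1 +\<close> covers \<open>k = 0\<close>.\<close>
    moreover have "\<forall>\<^sub>F x in away. \<forall>y. dist x y < real k \<longrightarrow> dist (\<psi> x) (\<psi> y) < 1 / (1 + real k)"
      by (rule slow_mapD[OF \<psi>]) (simp add: add_pos_nonneg)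
    ultimately show ?thesis
    proof eventually_elim
      case (elim x)
      have "real k * norm (\<psi> x - \<psi> y) \<le> 1 + 2 * B * dist x y" for y
      proof (cases "dist x y < real k")
        case True
        then have "norm (\<psi> x - \<psi> y) \<le> 1 / (1 + real k)"
          using elim by (auto simp: dist_norm less_imp_le)
        then have "real k * norm (\<psi> x - \<psi> y) \<le> real k * (1 / (1 + real k))"
          by (intro mult_left_mono) auto
        also have "\<dots> \<le> 1" by simp
        finally show ?thesis using mult_nonneg_nonneg[of "2 * B" "dist x y"] B(1) zero_le_dist[of x y] by linarith
      next
        case False
        then have "real k * norm (\<psi> x - \<psi> y) \<le> dist x y * (2 * B)"
          using \<psi>B by (intro mult_mono) auto
        then show ?thesis by (simp add: mult_ac)
      qed
      then show ?case using elim unfolding P_def by blast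
    qed
  qed
  then obtain r where r: "\<And>k x. r k < dist undefined x \<Longrightarrow> P (real k) x"
    unfolding eventually_away by metis
  \<comment> \<open>Zero keeps this set nonempty, and the bound by the distance keeps it finite, so
    that its maximum exists.\<close>
  define N where "N x = {k. k = 0 \<or> (real k \<le> dist undefined x \<and> r k < dist undefined x)}" for x :: 'a
  have fin: "finite (N x)" for x
    unfolding N_def finite_nat_set_iff_bounded_le
    by (rule exI[of _ "nat \<lfloor>dist undefined x\<rfloor>"]) (auto intro: le_nat_floor)
  define \<beta> where "\<beta> x = real (Max (N x))" for x :: 'a
  have "N x \<noteq> {}" for x by (auto simp: N_def)
  then have "Max (N x) \<in> N x" for x
    using fin by (rule Max_in[rotated])
  moreover have "k = 0 \<or> r k < dist undefined x" if "k \<in> N x" for k x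
    using that by (auto simp: N_def)
  ultimately have MaxN: "Max (N x) = 0 \<or> r (Max (N x)) < dist undefined x" for x
    by blast
  have P0: "P 0 x" for x
    using D(2) B(1) by (simp add: P_def)
  have P\<beta>: "P (\<beta> x) x" for x
  proof (cases "Max (N x) = 0")
    case True
    then show ?thesis using P0 by (simp add: \<beta>_def)
  next
    case False
    then show ?thesis using MaxN[of x] r[of "Max (N x)" x] by (simp add: \<beta>_def)
  qed
  have \<beta>_large: "real k \<le> \<beta> x" if "max (real k) (r k) < dist undefined x" for k x
  proof -
    have "k \<in> N x" using that by (simp add: N_def)
    then show ?thesis using Max_ge[OF fin] by (simp add: \<beta>_def)
  qed
  have \<beta>0: "0 \<le> \<beta> x" for x by (simp add: \<beta>_def)
  define \<rho> where "\<rho> x = (INF a\<in>UNIV. \<beta> a + 1 * dist x a)" for x :: 'a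
  have bdd: "bdd_below (range (\<lambda>a. \<beta> a + 1 * dist x a))" for x
    using \<beta>0 by (intro bdd_belowI2[of _ 0]) auto
  have \<rho>_lip: "\<bar>\<rho> x - \<rho> y\<bar> \<le> dist x y" for x y
    using inf_convolution_lipschitz[of UNIV 1 "\<lambda>_. 0" \<beta> x y] \<beta>0 unfolding \<rho>_def by simp
  have \<rho>0: "0 \<le> \<rho> x" for x
    unfolding \<rho>_def using \<beta>0 by (intro cINF_greatest) auto
  have \<rho>\<beta>: "\<rho> x \<le> \<beta> x" for x
    unfolding \<rho>_def using cINF_lower[OF bdd, of x x] by simp
  have \<rho>D: "\<rho> x \<le> D x" for x
    using \<rho>\<beta>[of x] P\<beta>[of x] by (simp add: P_def)
  have "filterlim \<rho> at_top away"
    unfolding filterlim_at_top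
  proof
    fix Z :: real
    obtain k :: nat where k: "Z \<le> real k" using real_arch_simple by blast
    \<comment> \<open>Either \<open>a\<close> is far out and \<open>\<beta> a\<close> is large, or
      \<open>a\<close> is near the base point and then \<open>dist x a\<close> exceeds
      \<open>k\<close>.\<close>
    have "Z \<le> \<rho> x" if x: "max (real k) (r k) + real k < dist undefined x" for x
      unfolding \<rho>_def
    proof (rule cINF_greatest)
      fix a
      show "Z \<le> \<beta> a + 1 * dist x a"
      proof (cases "max (real k) (r k) < dist undefined a")
        case True
        then show ?thesis using \<beta>_large[OF True] k zero_le_dist[of x a] by linarith
      next
        case False
        then show ?thesis
          using x k \<beta>0[of a] dist_triangle[of undefined x a] dist_commute[of a x] by linarith
      qed
    qed simp
    then show "\<forall>\<^sub>F x in away. Z \<le> \<rho> x" unfolding eventually_away by blast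
  qed
  moreover have "asymp_lipschitz_on UNIV (\<lambda>x. \<rho> x *\<^sub>R \<psi> x)"
    unfolding asymp_lipschitz_on_def
  proof (intro exI conjI ballI)
    show "0 \<le> 3 * B" "(0::real) \<le> 1" using B by auto
    fix x y
    \<comment> \<open>The first term is bounded through \<open>\<rho> \<le> \<beta>\<close> and
      admissibility of \<open>\<beta> x\<close>, the second through the Lipschitz bound of
      \<open>\<rho>\<close>.\<close>
    have "\<rho> x *\<^sub>R \<psi> x - \<rho> y *\<^sub>R \<psi> y = \<rho> x *\<^sub>R (\<psi> x - \<psi> y) + (\<rho> x - \<rho> y) *\<^sub>R \<psi> y"
      by (simp add: algebra_simps)
    then have "norm (\<rho> x *\<^sub>R \<psi> x - \<rho> y *\<^sub>R \<psi> y) \<le> \<rho> x * norm (\<psi> x - \<psi> y) + \<bar>\<rho> x - \<rho> y\<bar> * norm (\<psi> y)"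
      using norm_triangle_ineq[of "\<rho> x *\<^sub>R (\<psi> x - \<psi> y)" "(\<rho> x - \<rho> y) *\<^sub>R \<psi> y"] \<rho>0[of x] by simp
    moreover have "\<rho> x * norm (\<psi> x - \<psi> y) \<le> \<beta> x * norm (\<psi> x - \<psi> y)"
      using \<rho>\<beta> by (intro mult_right_mono) auto
    moreover have "\<beta> x * norm (\<psi> x - \<psi> y) \<le> 1 + 2 * B * dist x y"
      using P\<beta>[of x] by (simp add: P_def)
    moreover have "\<bar>\<rho> x - \<rho> y\<bar> * norm (\<psi> y) \<le> dist x y * B"
      using \<rho>_lip B by (intro mult_mono) auto
    ultimately show "dist (\<rho> x *\<^sub>R \<psi> x) (\<rho> y *\<^sub>R \<psi> y) \<le> 3 * B * dist x y + 1"
      by (simp add: dist_norm algebra_simps)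
  qed
  ultimately show thesis
    by (intro that[OF \<rho>_lip \<rho>0 \<rho>D])
qed

lemma proper_map_onI:
  fixes f :: "'a::metric_space \<Rightarrow> 'b::real_normed_vector"
  assumes X: "proper_metric_space TYPE('a)" and A: "closed A" and f: "continuous_on A f"
    and lim: "\<And>b. \<exists>r. \<forall>x\<in>A. r < dist undefined x \<longrightarrow> b < norm (f x)"
  shows "proper_map_on A f"
  unfolding proper_map_on_def
proof (intro allI impI)
  fix K :: "'b set" assume "compact K"
  then obtain b where b: "\<And>z. z \<in> K \<Longrightarrow> norm z \<le> b"
    using compact_imp_bounded bounded_iff by metis
  obtain r where r: "\<And>x. x \<in> A \<Longrightarrow> r < dist undefined x \<Longrightarrow> b < norm (f x)"
    using lim by blast
  have "{x\<in>A. f x \<in> K} \<subseteq> cball undefined r"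
    using b r by fastforce
  then have "bounded {x\<in>A. f x \<in> K}"
    using bounded_cball bounded_subset by blast
  moreover have "closed {x\<in>A. f x \<in> K}"
    using continuous_closed_preimage[OF f A compact_imp_closed[OF \<open>compact K\<close>]]
    by (simp add: vimage_def Int_def)
  ultimately show "compact {x\<in>A. f x \<in> K}"
    using proper_metric_spaceD[OF X] by blast
qed

lemma proper_map_onD:
  fixes f :: "'a::metric_space \<Rightarrow> 'b::euclidean_space"
  assumes "proper_map_on A f"
  shows "\<exists>r. \<forall>x\<in>A. r < dist undefined x \<longrightarrow> b < norm (f x)"
proof -
  have "compact {x\<in>A. f x \<in> cball 0 b}"
    using assms[unfolded proper_map_on_def, rule_format, OF compact_cball] .
  then have "bounded {x\<in>A. f x \<in> cball 0 b}"
    by (rule compact_imp_bounded)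
  then obtain r where r: "\<And>x. x \<in> {x\<in>A. f x \<in> cball 0 b} \<Longrightarrow> dist undefined x \<le> r"
    using bounded_any_center[of "{x\<in>A. f x \<in> cball 0 b}" undefined] by auto
  show ?thesis
  proof (intro exI ballI impI)
    fix x assume "x \<in> A" "r < dist undefined x"
    then show "b < norm (f x)" using r[of x] by (rule_tac ccontr) auto
  qed
qed

section \<open>Extension of proper maps and of sphere-valued maps\<close>

text \<open>Encodes the classical test for dimension at most \<open>n\<close> by extension of maps
  into the \<open>n\<close>-sphere: the set where the map is prescribed is given by
  \<open>1 \<le> norm (F x)\<close>, the map there by \<open>sgn (F x)\<close>. Carrying both in a
  global \<open>F\<close> avoids partial maps.\<close>

definition slow_sphere_extension :: "'a::metric_space itself \<Rightarrow> 'n::finite itself \<Rightarrow> bool" where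
  "slow_sphere_extension _ _ \<longleftrightarrow>
     (\<forall>F::'a \<Rightarrow> real^'n. slow_map F \<longrightarrow>
        (\<exists>G::'a \<Rightarrow> real^'n. slow_map G \<and>
           (\<forall>\<^sub>F x in away. norm (G x) = 1 \<and> (1 \<le> norm (F x) \<longrightarrow> G x = sgn (F x)))))"

lemma asymp_lipschitz_on_max:
  fixes f g :: "'a::metric_space \<Rightarrow> real"
  assumes "asymp_lipschitz_on A f" "asymp_lipschitz_on A g"
  shows "asymp_lipschitz_on A (\<lambda>x. max (f x) (g x))"
proof -
  obtain L s M t where L: "0 \<le> L" "0 \<le> s" "0 \<le> M" "0 \<le> t"
    and f: "\<And>x y. x \<in> A \<Longrightarrow> y \<in> A \<Longrightarrow> \<bar>f x - f y\<bar> \<le> L * dist x y + s"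
    and g: "\<And>x y. x \<in> A \<Longrightarrow> y \<in> A \<Longrightarrow> \<bar>g x - g y\<bar> \<le> M * dist x y + t"
    using assms unfolding asymp_lipschitz_on_def dist_real_def by metis
  have "\<bar>max (f x) (g x) - max (f y) (g y)\<bar> \<le> (L + M) * dist x y + (s + t)"
    if "x \<in> A" "y \<in> A" for x y
  proof -
    have "0 \<le> L * dist x y" "0 \<le> M * dist x y" using L by auto
    then show ?thesis
      using f[OF that] g[OF that] L by (simp add: algebra_simps)
  qed
  then show ?thesis
    unfolding asymp_lipschitz_on_def dist_real_def
    using L by (intro exI[of _ "L + M"] exI[of _ "s + t"]) auto
qed

lemma asymp_lipschitz_on_subset:
  "asymp_lipschitz_on B f \<Longrightarrow> A \<subseteq> B \<Longrightarrow> asymp_lipschitz_on A f"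
  unfolding asymp_lipschitz_on_def by blast

lemma dimc_le_imp_slow_sphere_extension:
  assumes X: "proper_metric_space TYPE('a::metric_space)"
    and dim: "dimc_le TYPE('a) TYPE('n::finite)"
  shows "slow_sphere_extension TYPE('a) TYPE('n)"
  unfolding slow_sphere_extension_def
proof (intro allI impI)
  fix F :: "'a \<Rightarrow> real^'n"
  assume F: "slow_map F"
  define A where "A = {x. 1 \<le> norm (F x)}"
  have "closed A"
    unfolding A_def by (intro closed_Collect_le continuous_intros slow_map_continuous[OF F])
  \<comment> \<open>Flooring the denominator at 1 keeps \<open>\<psi>\<close> slow across zeros of
    \<open>F\<close> and changes nothing on \<open>A\<close>.\<close>
  define \<psi> where "\<psi> x = F x /\<^sub>R max 1 (norm (F x))" for x
  have \<psi>: "slow_map \<psi>"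
    unfolding \<psi>_def by (intro slow_map_divide_max slow_map_norm F) simp
  have \<psi>A: "\<psi> x = sgn (F x)" "norm (\<psi> x) = 1" if "x \<in> A" for x
  proof -
    show *: "\<psi> x = sgn (F x)"
      using that by (auto simp: A_def \<psi>_def sgn_div_norm max_def)
    show "norm (\<psi> x) = 1"
      using that unfolding * norm_sgn A_def by auto
  qed
  obtain \<rho> where \<rho>_lip: "\<And>x y. \<bar>\<rho> x - \<rho> y\<bar> \<le> dist x y" and \<rho>0: "\<And>x. 0 \<le> \<rho> x"
    and \<rho>_lim: "filterlim \<rho> at_top away" and \<rho>\<psi>: "asymp_lipschitz_on UNIV (\<lambda>x. \<rho> x *\<^sub>R \<psi> x)"
    by (rule slowly_growing_function[OF \<psi> filterlim_dist_away]) auto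
  have "continuous_on UNIV \<rho>"
    using \<rho>_lip by (intro lipschitz_imp_continuous_on[of _ 1]) (auto simp: dist_real_def)
  then have cont: "continuous_on A (\<lambda>x. \<rho> x *\<^sub>R \<psi> x)"
    using slow_map_continuous[OF \<psi>]
    by (intro continuous_on_scaleR) (auto intro: continuous_on_subset)
  have "proper_map_on A (\<lambda>x. \<rho> x *\<^sub>R \<psi> x)"
  proof (rule proper_map_onI[OF X \<open>closed A\<close> cont])
    fix b
    have "\<forall>\<^sub>F x in away. b < \<rho> x"
      using \<rho>_lim by (simp add: filterlim_at_top_dense)
    then show "\<exists>r. \<forall>x\<in>A. r < dist undefined x \<longrightarrow> b < norm (\<rho> x *\<^sub>R \<psi> x)"
      unfolding eventually_away using \<rho>0 \<psi>A by (auto simp: abs_of_nonneg)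
  qed
  moreover have "asymp_lipschitz_on A (\<lambda>x. \<rho> x *\<^sub>R \<psi> x)"
    using \<rho>\<psi> asymp_lipschitz_on_subset by blast
  ultimately have "closed A \<and> continuous_on A (\<lambda>x. \<rho> x *\<^sub>R \<psi> x) \<and>
      proper_map_on A (\<lambda>x. \<rho> x *\<^sub>R \<psi> x) \<and> asymp_lipschitz_on A (\<lambda>x. \<rho> x *\<^sub>R \<psi> x)"
    using \<open>closed A\<close> cont by blast
  from dim[unfolded dimc_le_def, rule_format, OF this]
  obtain g :: "'a \<Rightarrow> real^'n"
    where g: "continuous_on UNIV g" "proper_map_on UNIV g" "asymp_lipschitz_on UNIV g"
      and gA: "\<And>x. x \<in> A \<Longrightarrow> g x = \<rho> x *\<^sub>R \<psi> x"
    by blast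
  have g_lim: "\<forall>\<^sub>F x in away. b < norm (g x)" for b
    using proper_map_onD[OF g(2), of b] unfolding eventually_away by simp
  \<comment> \<open>Properness of \<open>g\<close> makes the denominator tend to infinity, as the
    quotient lemma demands; the floor 1 handles zeros of \<open>g\<close>.\<close>
  define G where "G x = g x /\<^sub>R max 1 (norm (g x))" for x
  have "slow_map G"
    unfolding G_def
  proof (rule slow_map_quotient)
    show "asymp_lipschitz_on UNIV (\<lambda>x. max 1 (norm (g x)))"
      by (intro asymp_lipschitz_on_max asymp_lipschitz_on_norm g)
        (rule asymp_lipschitz_on_bounded[of _ _ 1], simp)
    have "\<forall>\<^sub>F x in away. Z \<le> max 1 (norm (g x))" for Z
      using g_lim[of Z] by eventually_elim simp
    then show "filterlim (\<lambda>x. max 1 (norm (g x))) at_top away"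
      unfolding filterlim_at_top by blast
  qed (auto intro!: continuous_intros g)
  moreover have "\<forall>\<^sub>F x in away. norm (G x) = 1 \<and> (1 \<le> norm (F x) \<longrightarrow> G x = sgn (F x))"
    using g_lim[of 1]
  proof eventually_elim
    case (elim x)
    then have "g x \<noteq> 0" by auto
    then have "norm (G x) = 1" using elim by (simp add: G_def max_def)
    moreover have "G x = sgn (F x)" if "1 \<le> norm (F x)"
    proof -
      have "x \<in> A" using that by (simp add: A_def)
      \<comment> \<open>On \<open>A\<close> the factor \<open>\<rho> x\<close> is exactly the length
        of \<open>g x\<close>, so normalization cancels it.\<close>
      have "norm (g x) = \<rho> x"
        using gA[OF \<open>x \<in> A\<close>] \<psi>A[OF \<open>x \<in> A\<close>] \<rho>0[of x] by simp
      then show ?thesis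
        using elim gA[OF \<open>x \<in> A\<close>] \<psi>A(1)[OF \<open>x \<in> A\<close>] by (simp add: G_def max_def)
    qed
    ultimately show ?case by blast
  qed
  ultimately show "\<exists>G. slow_map G \<and>
      (\<forall>\<^sub>F x in away. norm (G x) = 1 \<and> (1 \<le> norm (F x) \<longrightarrow> G x = sgn (F x)))"
    by blast
qed

section \<open>Extending proper asymptotically Lipschitz maps\<close>

text \<open>Tietze in each coordinate. It later removes the bounded error of a near extension; a
  worse bound \<open>C'\<close> does no damage there.\<close>

lemma bounded_continuous_extension:
  fixes f :: "'a::metric_space \<Rightarrow> real^'n"
  assumes "closed A" "continuous_on A f" and C: "\<And>x. x \<in> A \<Longrightarrow> norm (f x) \<le> C"
  obtains g C' where "continuous_on UNIV g" "\<And>x. norm (g x) \<le> C'" "\<And>x. x \<in> A \<Longrightarrow> g x = f x"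
proof -
  \<comment> \<open>With \<open>A\<close> empty, \<open>C\<close> may be negative; the absolute
    value keeps the interval nonempty.\<close>
  have "\<exists>g. continuous_on UNIV g \<and> range g \<subseteq> {-\<bar>C\<bar>..\<bar>C\<bar>} \<and> (\<forall>x\<in>A. g x = f x $ i)" for i
  proof -
    have "\<bar>f x $ i\<bar> \<le> \<bar>C\<bar>" if "x \<in> A" for x
      using C[OF that] component_le_norm_cart[of "f x" i] by simp
    then have "(\<lambda>x. f x $ i) ` A \<subseteq> {-\<bar>C\<bar>..\<bar>C\<bar>}"
      by (fastforce simp: abs_le_iff)
    moreover have "continuous_map (top_of_set A) euclideanreal (\<lambda>x. f x $ i)"
      using assms by (simp add: continuous_intros)
    moreover have "normal_space (euclidean :: 'a topology)"
      by (intro metrizable_imp_normal_space metrizable_space_euclidean)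
    ultimately obtain g where "continuous_map euclidean euclideanreal g"
      "g ` topspace (euclidean :: 'a topology) \<subseteq> {-\<bar>C\<bar>..\<bar>C\<bar>}" "\<And>x. x \<in> A \<Longrightarrow> g x = f x $ i"
      using \<open>closed A\<close> Tietze_extension_realinterval[of euclidean A "{-\<bar>C\<bar>..\<bar>C\<bar>}" "\<lambda>x. f x $ i"]
      by (auto simp: is_interval_cc)
    then show ?thesis by auto
  qed
  then obtain g where g: "\<And>i. continuous_on UNIV (g i)" "\<And>i. range (g i) \<subseteq> {-\<bar>C\<bar>..\<bar>C\<bar>}"
    "\<And>i x. x \<in> A \<Longrightarrow> g i x = f x $ i"
    by metis
  show thesis
  proof
    show "continuous_on UNIV (\<lambda>x. \<chi> i. g i x)"
      by (intro continuous_on_vec_lambda g)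
    show "(\<chi> i. g i x) = f x" if "x \<in> A" for x
      using g(3)[OF that] by (simp add: vec_eq_iff)
    fix x
    have "\<bar>g i x\<bar> \<le> \<bar>C\<bar>" for i
      using g(2)[of i] by (simp add: image_subset_iff abs_le_iff minus_le_iff)
    then have "norm (\<chi> i. g i x) \<le> (\<Sum>i\<in>(UNIV::'n set). \<bar>C\<bar>)"
      by (intro order_trans[OF norm_le_l1_cart] sum_mono) simp
    then show "norm (\<chi> i. g i x) \<le> real CARD('n) * \<bar>C\<bar>" by simp
  qed
qed

lemma infdist_lipschitz: "\<bar>infdist x A - infdist y A\<bar> \<le> dist x y"
  using infdist_triangle[of x A y] infdist_triangle[of y A x] by (simp add: dist_commute)

text \<open>Up to a bounded correction, an extension of \<open>f\<close> is the sum of two pieces: a slowly growing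
  multiple \<open>\<rho>\<close> of a sphere-valued slow map, and \<open>\<sigma> F\<close>, where \<open>\<sigma>\<close> lives on a conical neighbourhood of
  \<open>A\<close> and supplies the missing length of \<open>f\<close> there.\<close>

lemma slow_sphere_extension_imp_near_extension:
  fixes f :: "'a::metric_space \<Rightarrow> real^'n"
  assumes X: "proper_metric_space TYPE('a)"
    and ext: "slow_sphere_extension TYPE('a) TYPE('n)"
    and A: "closed A" "A \<noteq> {}"
    and f: "continuous_on A f" "proper_map_on A f" "asymp_lipschitz_on A f"
  obtains g :: "'a \<Rightarrow> real^'n" and C
  where "continuous_on UNIV g" "asymp_lipschitz_on UNIV g"
    "\<And>b. \<forall>\<^sub>F x in away. b < norm (g x)" "\<And>x. x \<in> A \<Longrightarrow> norm (f x - g x) \<le> C"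
proof -
  obtain h :: "'a \<Rightarrow> real^'n" and L C
    where LC: "0 \<le> L" "0 \<le> C" and h: "\<And>x y. norm (h x - h y) \<le> L * dist x y"
      and hf: "\<And>x. x \<in> A \<Longrightarrow> norm (h x - f x) \<le> C"
    using asymp_lipschitz_on_near_lipschitz[OF f(3) \<open>A \<noteq> {}\<close>] by metis
  have cont_h: "continuous_on UNIV h"
    using h LC(1) by (intro lipschitz_imp_continuous_on[of _ L]) (auto simp: dist_norm)
  have al_h: "asymp_lipschitz_on UNIV h"
    using h LC(1) by (intro asymp_lipschitz_on_lipschitz[of L]) (auto simp: dist_norm)
  have h_norm: "\<bar>norm (h x) - norm (h y)\<bar> \<le> L * dist x y" for x y
    using h[of x y] norm_triangle_ineq3[of "h x" "h y"] by linarith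
  define d where "d x = infdist x A" for x
  have d0: "0 \<le> d x" for x by (simp add: d_def infdist_nonneg)
  have d_lip: "\<bar>d x - d y\<bar> \<le> dist x y" for x y
    unfolding d_def by (rule infdist_lipschitz)
  have dA: "d x = 0" if "x \<in> A" for x using that by (simp add: d_def)
  \<comment> \<open>The first term forces \<open>norm (F x) \<le> 1\<close>, the second makes
    \<open>D\<close> grow away from \<open>A\<close>, and 1 keeps it positive. On \<open>A\<close>
    and far out, \<open>D\<close> is the norm of \<open>h\<close>, so \<open>F\<close> is a unit
    vector there.\<close>
  define D where "D x = max (max (norm (h x)) (d x)) 1" for x
  have D_lip: "\<bar>D x - D y\<bar> \<le> (L + 1) * dist x y" for x y
  proof -
    have "0 \<le> L * dist x y" using LC by simp
    then show ?thesis
      using h_norm[of x y] d_lip[of x y] zero_le_dist[of x y] unfolding D_def distrib_right by linarith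
  qed
  have D1: "1 \<le> D x" for x by (simp add: D_def)
  have D_lim: "\<forall>\<^sub>F x in away. b < D x" for b
  proof -
    \<comment> \<open>If \<open>D x \<le> b\<close>, some \<open>a\<close> in \<open>A\<close> lies
      within \<open>b + 1\<close> of \<open>x\<close>; then
      \<open>norm (h a) \<le> b + L * (b + 1)\<close>, and passing from \<open>h\<close> to
      \<open>f\<close> costs \<open>C\<close>. Properness of \<open>f\<close> confines such
      \<open>a\<close>, hence \<open>x\<close>.\<close>
    obtain r where r: "\<And>x. x \<in> A \<Longrightarrow> r < dist undefined x \<Longrightarrow> b + L * (b + 1) + C < norm (f x)"
      using proper_map_onD[OF f(2), of "b + L * (b + 1) + C"] by auto
    have "b < D x" if x: "r + b + 1 < dist undefined x" for x
    proof (rule ccontr)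
      assume "\<not> b < D x"
      then have "norm (h x) \<le> b" "d x < b + 1" by (auto simp: D_def)
      then obtain a where a: "a \<in> A" "dist x a < b + 1"
        using \<open>A \<noteq> {}\<close> unfolding d_def infdist_notempty[OF \<open>A \<noteq> {}\<close>]
        by (subst (asm) cINF_less_iff) (auto intro: bdd_belowI2[of _ 0])
      have "L * dist x a \<le> L * (b + 1)" using a LC by (intro mult_left_mono) auto
      then have "norm (f a) \<le> b + L * (b + 1) + C"
        using \<open>norm (h x) \<le> b\<close> h_norm[of x a] hf[OF a(1)] norm_triangle_ineq3[of "h a" "f a"] by linarith
      then have "dist undefined a \<le> r" using r[OF a(1)] by linarith
      then show False
        using x a dist_triangle[of undefined x a] dist_commute[of a x] by linarith
    qed
    then show ?thesis unfolding eventually_away by blast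
  qed
  have D_top: "filterlim D at_top away"
    using D_lim by (simp add: filterlim_at_top_dense)
  define F where "F x = h x /\<^sub>R D x" for x
  have hD: "norm (h x) \<le> D x" for x by (simp add: D_def)
  have cont_D: "continuous_on UNIV D"
    using D_lip LC by (intro lipschitz_imp_continuous_on[of _ "L + 1"]) (auto simp: dist_real_def)
  have F: "slow_map F"
    unfolding F_def
  proof (rule slow_map_quotient[OF cont_h al_h cont_D _ D_top hD])
    show "asymp_lipschitz_on UNIV D"
      using D_lip LC by (intro asymp_lipschitz_on_lipschitz[of "L + 1"]) (auto simp: dist_real_def)
    show "0 < D x" for x using D1[of x] by simp
  qed
  obtain G :: "'a \<Rightarrow> real^'n" where G: "slow_map G"
    and GF: "\<forall>\<^sub>F x in away. norm (G x) = 1 \<and> (1 \<le> norm (F x) \<longrightarrow> G x = sgn (F x))"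
    using ext F unfolding slow_sphere_extension_def by blast
  have D0: "0 \<le> D x" for x using D1[of x] by simp
  obtain \<rho> where \<rho>_lip: "\<And>x y. \<bar>\<rho> x - \<rho> y\<bar> \<le> dist x y" and \<rho>0: "\<And>x. 0 \<le> \<rho> x"
    and \<rho>D: "\<And>x. \<rho> x \<le> D x" and \<rho>_lim: "filterlim \<rho> at_top away"
    and \<rho>G: "asymp_lipschitz_on UNIV (\<lambda>x. \<rho> x *\<^sub>R G x)"
    by (rule slowly_growing_function[OF G D_top D0]) auto
  \<comment> \<open>On \<open>A\<close> and far out, \<open>\<rho> + \<sigma>\<close> is exactly
    \<open>norm (h x)\<close>. Subtracting \<open>d\<close> makes \<open>\<sigma>\<close> vanish
    unless \<open>d x < norm (h x)\<close>, a region where \<open>F\<close> is a unit vector near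
    infinity and agrees with \<open>G\<close>.\<close>
  define \<sigma> where "\<sigma> x = max 0 (norm (h x) - d x - \<rho> x)" for x
  have \<sigma>_lip: "\<bar>\<sigma> x - \<sigma> y\<bar> \<le> (L + 2) * dist x y" for x y
    using h_norm[of x y] d_lip[of x y] \<rho>_lip[of x y] unfolding \<sigma>_def by (simp add: algebra_simps)
  have \<sigma>0: "0 \<le> \<sigma> x" for x by (simp add: \<sigma>_def)
  have \<sigma>D: "\<sigma> x \<le> D x" for x using d0[of x] \<rho>0[of x] unfolding \<sigma>_def D_def by linarith
  have F1: "norm (F x) \<le> 1" for x
    using hD[of x] D1[of x] by (simp add: F_def divide_simps)
  \<comment> \<open>This works for \<open>F\<close> and not for a general slow map: \<open>F\<close>
    varies at rate \<open>1 / D\<close>, and \<open>\<sigma> \<le> D\<close> compensates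
    exactly.\<close>
  have \<sigma>F: "asymp_lipschitz_on UNIV (\<lambda>x. \<sigma> x *\<^sub>R F x)"
  proof (rule asymp_lipschitz_on_lipschitz)
    show "0 \<le> 3 * L + 3" using LC by simp
    fix x y
    have "\<sigma> x * norm (F x - F y) \<le> D x * norm (F x - F y)"
      using \<sigma>D by (intro mult_right_mono) auto
    also have "\<dots> \<le> norm (h x - h y) + \<bar>D x - D y\<bar>"
      unfolding F_def using D1[of x] D1[of y] by (intro norm_quotient_diff_le hD) auto
    finally have 1: "\<sigma> x * norm (F x - F y) \<le> (2 * L + 1) * dist x y"
      using h[of x y] D_lip[of x y] by (simp add: algebra_simps)
    have 2: "\<bar>\<sigma> x - \<sigma> y\<bar> * norm (F y) \<le> (L + 2) * dist x y"
      using \<sigma>_lip[of x y] mult_left_mono[OF F1[of y], of "\<bar>\<sigma> x - \<sigma> y\<bar>"] by simp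
    have "\<sigma> x *\<^sub>R F x - \<sigma> y *\<^sub>R F y = \<sigma> x *\<^sub>R (F x - F y) + (\<sigma> x - \<sigma> y) *\<^sub>R F y"
      by (simp add: algebra_simps)
    then have "norm (\<sigma> x *\<^sub>R F x - \<sigma> y *\<^sub>R F y) \<le> \<sigma> x * norm (F x - F y) + \<bar>\<sigma> x - \<sigma> y\<bar> * norm (F y)"
      using norm_triangle_ineq[of "\<sigma> x *\<^sub>R (F x - F y)" "(\<sigma> x - \<sigma> y) *\<^sub>R F y"] \<sigma>0[of x] by simp
    then show "dist (\<sigma> x *\<^sub>R F x) (\<sigma> y *\<^sub>R F y) \<le> (3 * L + 3) * dist x y"
      using 1 2 unfolding dist_norm by (simp add: algebra_simps)
  qed
  define g where "g x = \<rho> x *\<^sub>R G x + \<sigma> x *\<^sub>R F x" for x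
  have cont_\<rho>: "continuous_on UNIV \<rho>"
    using \<rho>_lip by (intro lipschitz_imp_continuous_on[of _ 1]) (auto simp: dist_real_def)
  have cont_\<sigma>: "continuous_on UNIV \<sigma>"
    using \<sigma>_lip LC by (intro lipschitz_imp_continuous_on[of _ "L + 2"]) (auto simp: dist_real_def)
  have cont_g: "continuous_on UNIV g"
    unfolding g_def
    by (intro continuous_intros cont_\<rho> cont_\<sigma> slow_map_continuous[OF G] slow_map_continuous[OF F])
  have al_g: "asymp_lipschitz_on UNIV g"
    unfolding g_def by (intro asymp_lipschitz_on_add \<rho>G \<sigma>F)
  have unit: "norm (h x) = D x \<and> G x = F x"
    if "1 < D x" "d x \<le> norm (h x)" "1 \<le> norm (F x) \<longrightarrow> G x = sgn (F x)" for x
  proof -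
    have "norm (h x) = D x" using that by (simp add: D_def max_def split: if_splits)
    moreover from this have "norm (F x) = 1" using that(1) by (simp add: F_def)
    ultimately show ?thesis using that by (simp add: sgn_div_norm)
  qed
  \<comment> \<open>The two pieces cannot cancel: either \<open>\<sigma>\<close> vanishes, or
    \<open>G\<close> and \<open>F\<close> coincide and the lengths add.\<close>
  have g_\<rho>: "\<forall>\<^sub>F x in away. \<rho> x \<le> norm (g x)"
    using GF D_lim[of 1]
  proof eventually_elim
    case (elim x)
    show ?case
    proof (cases "\<sigma> x = 0")
      case True
      then show ?thesis using elim \<rho>0[of x] by (simp add: g_def)
    next
      case False
      then have "d x \<le> norm (h x)" using \<rho>0[of x] d0[of x] by (simp add: \<sigma>_def max_def split: if_splits)
      then have "G x = F x" using unit elim by blast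
      then have "g x = (\<rho> x + \<sigma> x) *\<^sub>R G x" by (simp add: g_def algebra_simps)
      then show ?thesis using elim \<rho>0[of x] \<sigma>0[of x] by simp
    qed
  qed
  have g_lim: "\<forall>\<^sub>F x in away. b < norm (g x)" for b
  proof -
    have "\<forall>\<^sub>F x in away. b < \<rho> x"
      using \<rho>_lim by (simp add: filterlim_at_top_dense)
    with g_\<rho> show ?thesis by eventually_elim simp
  qed
  have "\<forall>\<^sub>F x in away. x \<in> A \<longrightarrow> g x = h x"
    using GF D_lim[of 1]
  proof eventually_elim
    case (elim x)
    show ?case
    proof
      assume "x \<in> A"
      then have 1: "norm (h x) = D x" "G x = F x"
        using unit[of x] elim dA[of x] by auto
      have "g x = (\<rho> x + \<sigma> x) *\<^sub>R F x" using 1 by (simp add: g_def algebra_simps)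
      also have "\<rho> x + \<sigma> x = D x"
        using \<rho>D[of x] 1 dA[OF \<open>x \<in> A\<close>] by (simp add: \<sigma>_def)
      finally show "g x = h x" using D1[of x] by (simp add: F_def)
    qed
  qed
  then obtain r where r: "\<And>x. r < dist undefined x \<Longrightarrow> x \<in> A \<Longrightarrow> g x = h x"
    unfolding eventually_away by blast
  \<comment> \<open>Far out on \<open>A\<close> the error is \<open>norm (f x - h x)\<close>; the
    rest of \<open>A\<close> is compact, where continuity bounds it.\<close>
  have "compact (A \<inter> cball undefined r)"
    using A by (intro proper_metric_spaceD[OF X]) (auto simp: bounded_Int)
  moreover have "continuous_on (A \<inter> cball undefined r) (\<lambda>x. f x - g x)"
    using f(1) cont_g by (intro continuous_intros) (auto intro: continuous_on_subset)
  ultimately have "bounded ((\<lambda>x. f x - g x) ` (A \<inter> cball undefined r))"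
    using compact_continuous_image compact_imp_bounded by blast
  then obtain C' where "\<forall>z\<in>(\<lambda>x. f x - g x) ` (A \<inter> cball undefined r). norm z \<le> C'"
    unfolding bounded_iff by blast
  then have C': "norm (f x - g x) \<le> C'" if "x \<in> A" "dist undefined x \<le> r" for x
    using that by simp
  have "norm (f x - g x) \<le> max C C'" if "x \<in> A" for x
  proof (cases "r < dist undefined x")
    case True
    then show ?thesis using hf[OF that] r[OF True that] by (simp add: norm_minus_commute)
  next
    case False
    then show ?thesis using C'[OF that] by simp
  qed
  then show thesis
    by (rule that[OF cont_g al_g g_lim])
qed

text \<open>The error \<open>f - g\<close> on \<open>A\<close> is bounded and continuous, so it
  extends to a bounded continuous \<open>k\<close>, and \<open>g + k\<close> keeps the large-scale
  properties of \<open>g\<close>.\<close>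

lemma slow_sphere_extension_imp_dimc_le:
  assumes X: "proper_metric_space TYPE('a::metric_space)"
    and ext: "slow_sphere_extension TYPE('a) TYPE('n::finite)"
  shows "dimc_le TYPE('a) TYPE('n)"
proof -
  have main: "\<exists>g::'a \<Rightarrow> real^'n. continuous_on UNIV g \<and> proper_map_on UNIV g \<and>
      asymp_lipschitz_on UNIV g \<and> (\<forall>x\<in>A. g x = f x)"
    if A: "closed A" "A \<noteq> {}"
      and f: "continuous_on A f" "proper_map_on A f" "asymp_lipschitz_on A f"
    for A :: "'a set" and f :: "'a \<Rightarrow> real^'n"
  proof -
    obtain g :: "'a \<Rightarrow> real^'n" and C
      where g: "continuous_on UNIV g" "asymp_lipschitz_on UNIV g"
        "\<And>b. \<forall>\<^sub>F x in away. b < norm (g x)" and C: "\<And>x. x \<in> A \<Longrightarrow> norm (f x - g x) \<le> C"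
      using slow_sphere_extension_imp_near_extension[OF X ext A f] by metis
    have diff: "continuous_on A (\<lambda>x. f x - g x)"
      using f(1) g(1) by (intro continuous_intros) (auto intro: continuous_on_subset)
    obtain k C' where k: "continuous_on UNIV k" "\<And>x. norm (k x) \<le> C'"
      "\<And>x. x \<in> A \<Longrightarrow> k x = f x - g x"
      by (rule bounded_continuous_extension[OF A(1) diff C]) auto
    have cont: "continuous_on UNIV (\<lambda>x. g x + k x)"
      using g k by (intro continuous_intros)
    moreover have "proper_map_on UNIV (\<lambda>x. g x + k x)"
    proof (rule proper_map_onI[OF X closed_UNIV cont])
      fix b
      have "\<forall>\<^sub>F x in away. b < norm (g x + k x)"
        using g(3)[of "b + C'"]
      proof eventually_elim
        case (elim x)
        then show ?case
          using k(2)[of x] norm_triangle_ineq4[of "g x + k x" "k x"] by simp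
      qed
      then show "\<exists>r. \<forall>x\<in>UNIV. r < dist undefined x \<longrightarrow> b < norm (g x + k x)"
        unfolding eventually_away by blast
    qed
    moreover have "asymp_lipschitz_on UNIV (\<lambda>x. g x + k x)"
      using k(2) by (intro asymp_lipschitz_on_add g(2) asymp_lipschitz_on_bounded)
    ultimately show ?thesis
      using k(3) by (intro exI[of _ "\<lambda>x. g x + k x"]) auto
  qed
  show ?thesis
    unfolding dimc_le_def
  proof (intro allI impI)
    fix A :: "'a set" and f :: "'a \<Rightarrow> real^'n"
    assume f: "closed A \<and> continuous_on A f \<and> proper_map_on A f \<and> asymp_lipschitz_on A f"
    show "\<exists>g::'a \<Rightarrow> real^'n. continuous_on UNIV g \<and> proper_map_on UNIV g \<and>
        asymp_lipschitz_on UNIV g \<and> (\<forall>x\<in>A. g x = f x)"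
    proof (cases "A = {}")
      case True
      \<comment> \<open>The near extension relies on infima over a nonempty set, so a one-point set
        with the zero map replaces the empty one.\<close>
      have "proper_map_on {undefined::'a} (\<lambda>_. 0::real^'n)"
        unfolding proper_map_on_def by (auto intro: finite_imp_compact)
      moreover have "asymp_lipschitz_on {undefined::'a} (\<lambda>_. 0::real^'n)"
        by (rule asymp_lipschitz_on_bounded[of _ _ 0]) simp
      ultimately show ?thesis
        using main[of "{undefined}" "\<lambda>_. 0"] True by fastforce
    next
      case False
      then show ?thesis using main f by blast
    qed
  qed
qed

section \<open>Points and covers of the Higson corona\<close>

lemma topspace_higson_product: "topspace higson_product = extensional higson_functions"
  by (simp add: higson_product_def PiE_UNIV_domain PiE_def)

lemma higson_embedding_in_topspace: "higson_embedding x \<in> topspace higson_product"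
  by (simp add: topspace_higson_product higson_embedding_def)

lemma openin_higson_product_preimage:
  assumes "f \<in> higson_functions" "open V"
  shows "openin higson_product {q \<in> topspace higson_product. q f \<in> V}"
  unfolding higson_product_def
  using assms by (intro openin_continuous_map_preimage[OF continuous_map_product_projection])
    (auto simp: higson_product_def)

lemma closure_of_higson_value:
  assumes q: "q \<in> higson_product closure_of (higson_embedding ` S)"
    and f: "f \<in> higson_functions" and V: "open V" "q f \<in> V"
  obtains x where "x \<in> S" "f x \<in> V"
proof -
  have "q \<in> {q \<in> topspace higson_product. q f \<in> V}"
    using q V by (simp add: in_closure_of)
  moreover have "\<forall>T. q \<in> T \<and> openin higson_product T \<longrightarrow> (\<exists>y\<in>higson_embedding ` S. y \<in> T)"
    using q unfolding in_closure_of by (metis (no_types))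
  ultimately have "\<exists>y\<in>higson_embedding ` S. y \<in> {q \<in> topspace higson_product. q f \<in> V}"
    using openin_higson_product_preimage[OF f V(1)] by (metis (no_types, lifting))
  then obtain x where "x \<in> S" "higson_embedding x f \<in> V" by auto
  then show thesis
    using that f by (simp add: higson_embedding_def)
qed

lemma continuous_map_higson_embedding: "continuous_map euclidean higson_product higson_embedding"
  unfolding higson_product_def continuous_map_componentwise
proof (intro conjI ballI)
  show "higson_embedding ` topspace euclidean \<subseteq> extensional higson_functions"
    using higson_embedding_in_topspace by (auto simp: topspace_higson_product)
  fix f :: "'a \<Rightarrow> real" assume f: "f \<in> higson_functions"
  then have "continuous_on UNIV f"
    by (simp add: higson_functions_def higson_function_def)
  then show "continuous_map euclidean euclideanreal (\<lambda>x. higson_embedding x f)"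
    using f by (simp add: higson_embedding_def)
qed

lemma Hausdorff_higson_product: "Hausdorff_space higson_product"
  unfolding higson_product_def by (simp add: Hausdorff_space_product_topology)

section \<open>The corona of a proper metric space\<close>

context
  assumes X: "proper_metric_space TYPE('a::metric_space)"
begin

lemma mem_higson_functions: "(f :: 'a \<Rightarrow> real) \<in> higson_functions \<longleftrightarrow> slow_map f"
  using higson_function_iff_slow_map[OF X] by (simp add: higson_functions_def)

text \<open>Closed balls are compact, so their images are closed and a closure point outside
  \<open>X\<close> survives the removal of any ball. Conversely, the bump at \<open>z\<close>
  excludes \<open>z\<close> from the closure of a far away part. In this form the corona is visibly
  closed.\<close>

lemma higson_corona_points:
  "higson_compactification TYPE('a) - range (higson_embedding :: 'a \<Rightarrow> _) =
     (\<Inter>r. higson_product closure_of (higson_embedding ` {x::'a. r < dist undefined x}))"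
    (is "?L = (\<Inter>r. ?C r)")
proof (intro equalityI subsetI INT_I)
  fix q r assume q: "q \<in> ?L"
  let ?B = "higson_embedding ` cball (undefined::'a) r"
  have "compact (cball (undefined::'a) r)"
    using X by (simp add: proper_metric_space_def)
  then have "compactin higson_product ?B"
    by (intro image_compactin[OF _ continuous_map_higson_embedding]) simp
  then have "closedin higson_product ?B"
    by (intro compactin_imp_closedin Hausdorff_higson_product)
  then have "higson_product closure_of ?B = ?B"
    by (simp add: closure_of_eq)
  moreover have "range (higson_embedding :: 'a \<Rightarrow> _) = ?B \<union> higson_embedding ` {x. r < dist undefined x}"
    unfolding image_Un[symmetric] by (rule arg_cong[of _ _ "image higson_embedding"]) auto
  ultimately have "higson_compactification TYPE('a) = ?B \<union> ?C r"
    unfolding higson_compactification_def by simp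
  then show "q \<in> ?C r" using q by auto
next
  fix q assume q: "q \<in> (\<Inter>r. ?C r)"
  have "q \<in> ?C (-1)" using q by blast
  also have "?C (-1) \<subseteq> higson_compactification TYPE('a)"
    unfolding higson_compactification_def by (intro closure_of_mono) auto
  finally have "q \<in> higson_compactification TYPE('a)" .
  moreover have False if z: "q = higson_embedding z" for z :: 'a
  proof -
    let ?u = "\<lambda>x. max 0 (1 - dist z x)"
    have u: "?u \<in> higson_functions"
      unfolding mem_higson_functions by (rule slow_map_bump)
    have "q ?u \<in> {0<..}"
      using u by (simp add: z higson_embedding_def)
    moreover have "q \<in> ?C (1 + dist undefined z)" using q by blast
    ultimately obtain x where "x \<in> {x. 1 + dist undefined z < dist undefined x}" "?u x \<in> {0<..}"
      using closure_of_higson_value[OF _ u open_greaterThan] by blast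
    then show False
      using dist_triangle[of undefined x z] by (simp add: max_def split: if_splits)
  qed
  ultimately show "q \<in> ?L" by blast
qed

lemma topspace_higson_corona:
  "topspace (higson_corona TYPE('a)) =
     (\<Inter>r. higson_product closure_of (higson_embedding ` {x::'a. r < dist undefined x}))"
  unfolding higson_corona_def higson_corona_points topspace_subtopology
  using closure_of_subset_topspace[of higson_product] by blast

text \<open>Tychonoff's theorem, as Higson functions have bounded range.\<close>

lemma compactin_higson_box:
  "compactin higson_product (PiE higson_functions (\<lambda>f::'a \<Rightarrow> real. closure (range f)))"
  unfolding higson_product_def compactin_PiE
  by (auto simp: mem_higson_functions compact_closure slow_map_bounded)

lemma closure_of_higson_subset_box:
  "higson_product closure_of (higson_embedding ` S) \<subseteq>
     PiE higson_functions (\<lambda>f::'a \<Rightarrow> real. closure (range f))"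
proof (rule closure_of_minimal)
  have "f x \<in> closure (range f)" for f :: "'a \<Rightarrow> real" and x
    by (meson closure_subset rangeI subsetD)
  then show "higson_embedding ` S \<subseteq> PiE higson_functions (\<lambda>f::'a \<Rightarrow> real. closure (range f))"
    by (auto simp: higson_embedding_def)
  show "closedin higson_product (PiE higson_functions (\<lambda>f::'a \<Rightarrow> real. closure (range f)))"
    by (intro compactin_imp_closedin Hausdorff_higson_product compactin_higson_box)
qed

lemma compact_space_higson_corona: "compact_space (higson_corona TYPE('a))"
  unfolding higson_corona_def higson_corona_points
proof (rule compact_space_subtopology, rule closed_compactin[OF compactin_higson_box])
  show "(\<Inter>r. higson_product closure_of (higson_embedding ` {x::'a. r < dist undefined x}))
      \<subseteq> PiE higson_functions (\<lambda>f::'a \<Rightarrow> real. closure (range f))"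
    using closure_of_higson_subset_box by blast
  show "closedin higson_product
      (\<Inter>r. higson_product closure_of (higson_embedding ` {x::'a. r < dist undefined x}))"
    by (intro closedin_Inter) auto
qed

text \<open>The traces on \<open>X\<close> of the neighbourhoods of \<open>q\<close> meet every
  complement of a ball. Values of \<open>q\<close> at sums, maxima and the like can then be computed
  by limit rules and uniqueness of limits.\<close>

lemma higson_corona_filter:
  assumes q: "q \<in> topspace (higson_corona TYPE('a))"
  obtains \<F> :: "'a filter"
  where "\<F> \<noteq> bot" "\<F> \<le> away" "\<And>f. slow_map f \<Longrightarrow> (f \<longlongrightarrow> q f) \<F>"
proof
  let ?\<F> = "inf away (filtercomap higson_embedding (nhdsin higson_product q))"
  have q_top: "q \<in> topspace higson_product"
    using q by (simp add: higson_corona_def)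
  show "?\<F> \<noteq> bot"
  proof
    assume "?\<F> = bot"
    then have "eventually (\<lambda>_. False) ?\<F>" by simp
    then obtain P Q where "eventually P (away :: 'a filter)"
      and "eventually Q (filtercomap higson_embedding (nhdsin higson_product q))"
      and PQ: "\<And>x. P x \<Longrightarrow> Q x \<Longrightarrow> False"
      unfolding eventually_inf by blast
    then obtain r U where r: "\<And>x. r < dist undefined x \<Longrightarrow> P x"
      and U: "openin higson_product U" "q \<in> U" and UQ: "\<And>x. higson_embedding x \<in> U \<Longrightarrow> Q x"
      unfolding eventually_away eventually_filtercomap eventually_nhdsin using q_top by metis
    have "q \<in> higson_product closure_of (higson_embedding ` {x::'a. r < dist undefined x})"
      using q unfolding topspace_higson_corona by blast
    then obtain x :: 'a where "r < dist undefined x" "higson_embedding x \<in> U"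
      using U unfolding in_closure_of by blast
    then show False using r UQ PQ by blast
  qed
  show "?\<F> \<le> away" by simp
  show "(f \<longlongrightarrow> q f) ?\<F>" if "slow_map f" for f
  proof (rule topological_tendstoI)
    fix S assume S: "open S" "q f \<in> S"
    have f: "f \<in> higson_functions" using that by (simp add: mem_higson_functions)
    have "eventually (\<lambda>p. p f \<in> S) (nhdsin higson_product q)"
      unfolding eventually_nhdsin
      using openin_higson_product_preimage[OF f S(1)] S(2) q_top by blast
    then have "eventually (\<lambda>x. f x \<in> S) (filtercomap higson_embedding (nhdsin higson_product q))"
      using f by (auto simp: eventually_filtercomap higson_embedding_def)
    then show "eventually (\<lambda>x. f x \<in> S) ?\<F>"
      by (rule filter_leD[rotated]) simp
  qed
qed

lemma openin_higson_corona_preimage: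
  assumes "slow_map f" "open V"
  shows "openin (higson_corona TYPE('a)) {q \<in> topspace (higson_corona TYPE('a)). q f \<in> V}"
proof -
  have "{q \<in> topspace (higson_corona TYPE('a)). q f \<in> V} =
      {q \<in> topspace higson_product. q f \<in> V} \<inter>
        (higson_compactification TYPE('a) - range (higson_embedding :: 'a \<Rightarrow> _))"
    by (auto simp: higson_corona_def)
  moreover have "openin higson_product {q \<in> topspace higson_product. q f \<in> V}"
    using assms by (intro openin_higson_product_preimage) (simp_all add: mem_higson_functions)
  ultimately show ?thesis
    unfolding higson_corona_def openin_subtopology by blast
qed

text \<open>Compactness: otherwise points ever farther out with ever smaller values of
  \<open>h\<close> exist, and their nested closures share a corona point at which \<open>h\<close>
  is not positive.\<close>

lemma eventually_away_of_corona_pos: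
  fixes h :: "'a \<Rightarrow> real"
  assumes h: "slow_map h" and pos: "\<And>q. q \<in> topspace (higson_corona TYPE('a)) \<Longrightarrow> 0 < q h"
  obtains \<epsilon> where "0 < \<epsilon>" "\<forall>\<^sub>F x in away. \<epsilon> \<le> h x"
proof (rule ccontr)
  assume *: "\<not> thesis"
  define S where "S n = {x. real n < dist undefined x \<and> h x < 1 / real (Suc n)}" for n
  let ?C = "\<lambda>n. higson_product closure_of (higson_embedding ` S n)"
  let ?K = "PiE higson_functions (\<lambda>f::'a \<Rightarrow> real. closure (range f))"
  have hH: "h \<in> higson_functions" using h by (simp add: mem_higson_functions)
  have "(\<Inter>n. ?C n) \<noteq> {}"
  proof (rule compact_space_imp_nest)
    show "compact_space (subtopology higson_product ?K)"
      by (rule compact_space_subtopology[OF compactin_higson_box])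
    show "closedin (subtopology higson_product ?K) (?C n)" for n
      using closure_of_higson_subset_box by (intro closedin_subset_topspace) auto
    show "?C n \<noteq> {}" for n
    proof -
      have "\<not> (\<forall>\<^sub>F x in away. 1 / real (Suc n) \<le> h x)"
        using * that[of "1 / real (Suc n)"] by auto
      then have "S n \<noteq> {}"
        unfolding eventually_away S_def by (force simp: not_le)
      moreover have "higson_embedding ` S n \<subseteq> topspace higson_product"
        using higson_embedding_in_topspace by blast
      ultimately show ?thesis by (simp add: closure_of_eq_empty)
    qed
    show "decseq ?C"
      unfolding decseq_def
    proof (intro allI impI closure_of_mono image_mono)
      fix m n :: nat assume "m \<le> n"
      then have "1 / real (Suc n) \<le> 1 / real (Suc m)" by (simp add: frac_le)
      then show "S n \<subseteq> S m" using \<open>m \<le> n\<close> unfolding S_def by fastforce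
    qed
  qed
  then obtain q where q: "\<And>n. q \<in> ?C n" by blast
  have "q \<in> higson_product closure_of (higson_embedding ` {x. r < dist undefined x})" for r
  proof -
    obtain n :: nat where "r \<le> real n" using real_arch_simple by blast
    then have "S n \<subseteq> {x. r < dist undefined x}" by (auto simp: S_def)
    then show ?thesis using q[of n] closure_of_mono image_mono by (metis (no_types) subsetD)
  qed
  then have "0 < q h" using pos by (simp add: topspace_higson_corona)
  then obtain n :: nat where n: "1 / real (Suc n) < q h"
    using nat_approx_posE by metis
  then obtain x where "x \<in> S n" "h x \<in> {1 / real (Suc n)<..}"
    using closure_of_higson_value[OF q hH open_greaterThan] by (metis greaterThan_iff)
  then show False by (simp add: S_def)
qed

text \<open>A basic neighbourhood restricts finitely many coordinates; \<open>\<epsilon>\<close>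
  minus the total deviation from \<open>q\<close> in these is positive only inside it.\<close>

lemma higson_corona_nbhd_function:
  assumes V: "openin (higson_corona TYPE('a)) V" and q: "q \<in> V"
  obtains h :: "'a \<Rightarrow> real"
  where "slow_map h" "\<And>x. 0 \<le> h x" "0 < q h"
    "\<And>p. p \<in> topspace (higson_corona TYPE('a)) \<Longrightarrow> 0 < p h \<Longrightarrow> p \<in> V"
proof -
  let ?\<nu> = "higson_compactification TYPE('a) - range (higson_embedding :: 'a \<Rightarrow> _)"
  obtain W where W: "openin higson_product W" "V = W \<inter> ?\<nu>"
    using V unfolding higson_corona_def openin_subtopology by blast
  have q_top: "q \<in> topspace (higson_corona TYPE('a))"
    using openin_subset[OF V] q by blast
  have "q \<in> W" using W q by blast
  then obtain U where fin: "finite {f \<in> higson_functions. U f \<noteq> UNIV}"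
    and op: "\<And>f. f \<in> higson_functions \<Longrightarrow> open (U f)"
    and qU: "q \<in> PiE higson_functions U" and UW: "PiE higson_functions U \<subseteq> W"
    using W(1) unfolding higson_product_def openin_product_topology_alt by auto
  define E where "E = {f::'a \<Rightarrow> real. f \<in> higson_functions \<and> U f \<noteq> UNIV}"
  have "finite E" using fin by (simp add: E_def)
  have E_slow: "slow_map f" if "f \<in> E" for f
    using that by (simp add: E_def mem_higson_functions)
  have "\<exists>d>0. ball (q f) d \<subseteq> U f" if "f \<in> E" for f
    using that op qU unfolding E_def by (auto simp: PiE_iff open_contains_ball)
  then obtain d where d: "\<And>f. f \<in> E \<Longrightarrow> 0 < d f" "\<And>f. f \<in> E \<Longrightarrow> ball (q f) (d f) \<subseteq> U f"
    by metis
  \<comment> \<open>Inserting 1 covers a neighbourhood that restricts no coordinate.\<close>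
  define \<epsilon> where "\<epsilon> = Min (insert 1 (d ` E))"
  have \<epsilon>: "0 < \<epsilon>" "\<And>f. f \<in> E \<Longrightarrow> \<epsilon> \<le> d f"
    using \<open>finite E\<close> d(1) by (auto simp: \<epsilon>_def)
  define h where "h x = max 0 (\<epsilon> - (\<Sum>f\<in>E. \<bar>f x - q f\<bar>))" for x
  have h: "slow_map h"
    unfolding h_def
    by (intro slow_map_max slow_map_diff slow_map_sum slow_map_abs slow_map_const E_slow)
  have p_h: "p h = max 0 (\<epsilon> - (\<Sum>f\<in>E. \<bar>p f - q f\<bar>))"
    if "p \<in> topspace (higson_corona TYPE('a))" for p
  proof -
    obtain \<F> where \<F>: "\<F> \<noteq> bot" and lim: "\<And>f. slow_map f \<Longrightarrow> (f \<longlongrightarrow> p f) \<F>"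
      using higson_corona_filter[OF \<open>p \<in> _\<close>] by metis
    have "(h \<longlongrightarrow> max 0 (\<epsilon> - (\<Sum>f\<in>E. \<bar>p f - q f\<bar>))) \<F>"
      unfolding h_def by (intro tendsto_intros lim E_slow)
    then show ?thesis
      using tendsto_unique[OF \<F> lim[OF h]] by blast
  qed
  show thesis
  proof
    show "slow_map h" by (rule h)
    show "0 \<le> h x" for x by (simp add: h_def)
    show "0 < q h" using p_h[OF q_top] \<epsilon>(1) by simp
    fix p assume p: "p \<in> topspace (higson_corona TYPE('a))" "0 < p h"
    then have less: "(\<Sum>f\<in>E. \<bar>p f - q f\<bar>) < \<epsilon>" using p_h[OF p(1)] by (simp add: max_def split: if_splits)
    have "p f \<in> U f" if f: "f \<in> higson_functions" for f
    proof (cases "f \<in> E")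
      case True
      have "\<bar>p f - q f\<bar> \<le> (\<Sum>f\<in>E. \<bar>p f - q f\<bar>)"
        using \<open>finite E\<close> True by (intro member_le_sum) auto
      then have "p f \<in> ball (q f) (d f)"
        using less \<epsilon>(2)[OF True] by (simp add: dist_real_def abs_minus_commute)
      then show ?thesis using d(2)[OF True] by blast
    next
      case False
      then show ?thesis using f by (simp add: E_def)
    qed
    moreover have "p \<in> extensional higson_functions" "p \<in> ?\<nu>"
      using p(1) by (simp_all add: higson_corona_def topspace_higson_product)
    ultimately have "p \<in> PiE higson_functions U" "p \<in> ?\<nu>" by (auto simp: PiE_iff)
    then show "p \<in> V" using W UW by blast
  qed
qed

text \<open>A substitute for a partition of unity subordinate to the cover, living on the space itself.\<close>

lemma higson_corona_cover_functions:
  assumes I: "finite I" and U: "\<And>i. i \<in> I \<Longrightarrow> openin (higson_corona TYPE('a)) (U i)"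
    and cover: "topspace (higson_corona TYPE('a)) \<subseteq> (\<Union>i\<in>I. U i)"
  obtains h :: "'i \<Rightarrow> 'a \<Rightarrow> real" and \<epsilon>
  where "\<And>i. slow_map (h i)" "\<And>i x. 0 \<le> h i x"
    "\<And>i p. p \<in> topspace (higson_corona TYPE('a)) \<Longrightarrow> 0 < p (h i) \<Longrightarrow> p \<in> U i"
    "0 < \<epsilon>" "\<forall>\<^sub>F x in away. \<epsilon> \<le> (\<Sum>i\<in>I. h i x)"
proof -
  let ?\<nu> = "topspace (higson_corona TYPE('a))"
  let ?P = "\<lambda>q i h. i \<in> I \<and> slow_map h \<and> (\<forall>x::'a. 0 \<le> h x) \<and> 0 < q h \<and> (\<forall>p\<in>?\<nu>. 0 < p h \<longrightarrow> p \<in> U i)"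
  have "\<forall>q\<in>?\<nu>. \<exists>i h. ?P q i h"
  proof
    fix q assume q: "q \<in> ?\<nu>"
    obtain i where i: "i \<in> I" "q \<in> U i" using cover q by blast
    show "\<exists>i h. ?P q i h"
      by (rule higson_corona_nbhd_function[OF U[OF i(1)] i(2)]) (use i in blast)
  qed
  from bchoice[OF this] obtain \<iota> where "\<forall>q\<in>?\<nu>. \<exists>h. ?P q (\<iota> q) h" by blast
  from bchoice[OF this] obtain k where "\<forall>q\<in>?\<nu>. ?P q (\<iota> q) (k q)" by blast
  then have \<iota>: "\<And>q. q \<in> ?\<nu> \<Longrightarrow> \<iota> q \<in> I"
    and k: "\<And>q. q \<in> ?\<nu> \<Longrightarrow> slow_map (k q)" "\<And>q x. q \<in> ?\<nu> \<Longrightarrow> 0 \<le> k q (x::'a)"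
      "\<And>q. q \<in> ?\<nu> \<Longrightarrow> 0 < q (k q)" "\<And>q p. q \<in> ?\<nu> \<Longrightarrow> p \<in> ?\<nu> \<Longrightarrow> 0 < p (k q) \<Longrightarrow> p \<in> U (\<iota> q)"
    by simp_all
  define N where "N q = {p \<in> ?\<nu>. p (k q) \<in> {0<..}}" for q
  have "openin (higson_corona TYPE('a)) (N q)" if "q \<in> ?\<nu>" for q
    unfolding N_def by (intro openin_higson_corona_preimage k(1) that) simp
  moreover have "?\<nu> \<subseteq> \<Union> (N ` ?\<nu>)"
    using k(3) by (fastforce simp: N_def)
  ultimately have "\<exists>\<N>. finite \<N> \<and> \<N> \<subseteq> N ` ?\<nu> \<and> ?\<nu> \<subseteq> \<Union>\<N>"
    using compact_space_higson_corona[unfolded compact_space_alt, rule_format, of "N ` ?\<nu>"] by blast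
  then obtain Q where Q: "finite Q" "Q \<subseteq> ?\<nu>" and cov: "?\<nu> \<subseteq> \<Union> (N ` Q)"
    by (metis finite_subset_image)
  \<comment> \<open>All functions of the finite subcover assigned to the same index are merged,
    giving one function per \<open>i\<close>.\<close>
  define h where "h i x = (\<Sum>q\<in>{q\<in>Q. \<iota> q = i}. k q x)" for i x
  have h: "slow_map (h i)" for i
    unfolding h_def using Q k(1) by (intro slow_map_sum) auto
  have h0: "0 \<le> h i x" for i x
    unfolding h_def using Q k(2) by (intro sum_nonneg) auto
  have k0: "0 \<le> p (k q)" if "p \<in> ?\<nu>" "q \<in> Q" for p q
  proof (rule higson_corona_filter[OF that(1)])
    fix \<F> :: "'a filter"
    assume \<F>: "\<F> \<noteq> bot" and lim: "\<And>f. slow_map f \<Longrightarrow> (f \<longlongrightarrow> p f) \<F>"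
    have "q \<in> ?\<nu>" using that Q by blast
    then show ?thesis
      using tendsto_lowerbound[OF lim[OF k(1)[OF \<open>q \<in> ?\<nu>\<close>]] _ \<F>, of 0] k(2) by simp
  qed
  have h_value: "p (h i) = (\<Sum>q\<in>{q\<in>Q. \<iota> q = i}. p (k q))" if "p \<in> ?\<nu>" for p i
  proof (rule higson_corona_filter[OF that])
    fix \<F> :: "'a filter"
    assume \<F>: "\<F> \<noteq> bot" and lim: "\<And>f. slow_map f \<Longrightarrow> (f \<longlongrightarrow> p f) \<F>"
    have "(h i \<longlongrightarrow> (\<Sum>q\<in>{q\<in>Q. \<iota> q = i}. p (k q))) \<F>"
      unfolding h_def using Q by (intro tendsto_sum lim k(1)) auto
    then show ?thesis using tendsto_unique[OF \<F> lim[OF h]] by blast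
  qed
  have h_U: "p \<in> U i" if p: "p \<in> ?\<nu>" "0 < p (h i)" for p i
  proof -
    have "\<exists>q\<in>{q\<in>Q. \<iota> q = i}. 0 < p (k q)"
    proof (rule ccontr)
      assume "\<not> ?thesis"
      then have "(\<Sum>q\<in>{q\<in>Q. \<iota> q = i}. p (k q)) \<le> 0" by (intro sum_nonpos) (auto simp: not_less)
      then show False using p h_value by simp
    qed
    then show ?thesis using k(4) Q p by blast
  qed
  have sum_slow: "slow_map (\<lambda>x. \<Sum>i\<in>I. h i x)" by (intro slow_map_sum h)
  have sum_pos: "0 < p (\<lambda>x. \<Sum>i\<in>I. h i x)" if p: "p \<in> ?\<nu>" for p
  proof (rule higson_corona_filter[OF p])
    fix \<F> :: "'a filter"
    assume \<F>: "\<F> \<noteq> bot" and lim: "\<And>f. slow_map f \<Longrightarrow> (f \<longlongrightarrow> p f) \<F>"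
    have "((\<lambda>x. \<Sum>i\<in>I. h i x) \<longlongrightarrow> (\<Sum>i\<in>I. p (h i))) \<F>" by (intro tendsto_sum lim h)
    then have p_sum: "p (\<lambda>x. \<Sum>i\<in>I. h i x) = (\<Sum>i\<in>I. p (h i))"
      using tendsto_unique[OF \<F> lim[OF sum_slow]] by blast
    obtain q where q: "q \<in> Q" "0 < p (k q)" using cov p by (auto simp: N_def)
    have "p (k q) \<le> (\<Sum>q\<in>{q'\<in>Q. \<iota> q' = \<iota> q}. p (k q))"
      using Q(1) q k0[OF p] by (intro member_le_sum) auto
    also have "\<dots> = p (h (\<iota> q))" using h_value[OF p] by simp
    also have "\<dots> \<le> (\<Sum>i\<in>I. p (h i))"
      using I \<iota> q Q h_value[OF p] k0[OF p] by (intro member_le_sum) (auto intro!: sum_nonneg)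
    finally show ?thesis using q p_sum by simp
  qed
  show thesis
  proof (rule eventually_away_of_corona_pos[of "\<lambda>x. \<Sum>i\<in>I. h i x", OF sum_slow])
    show "0 < q (\<lambda>x. \<Sum>i\<in>I. h i x)" if "q \<in> ?\<nu>" for q
      using that by (rule sum_pos)
    fix \<epsilon> assume "0 < \<epsilon>" "\<forall>\<^sub>F x in away. \<epsilon> \<le> (\<Sum>i\<in>I. h i x)"
    then show thesis
      using h h0 h_U by (rule that[rotated -2])
  qed
qed

end

section \<open>From covering dimension to sphere-valued maps\<close>

lemma higson_corona_mono:
  fixes f g :: "'a::metric_space \<Rightarrow> real"
  assumes X: "proper_metric_space TYPE('a)" and q: "q \<in> topspace (higson_corona TYPE('a))"
    and f: "slow_map f" and g: "slow_map g" and le: "\<And>x. f x \<le> g x"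
  shows "q f \<le> q g"
proof (rule higson_corona_filter[OF X q])
  fix \<F> :: "'a filter"
  assume "\<F> \<noteq> bot" and lim: "\<And>f. slow_map f \<Longrightarrow> (f \<longlongrightarrow> q f) \<F>"
  then show ?thesis
    using tendsto_le[OF _ lim[OF g] lim[OF f]] le by simp
qed

text \<open>\<open>\<epsilon> - h\<close> is positive on the corona and hence near infinity.\<close>

lemma eventually_away_of_corona_nonpos:
  fixes h :: "'a::metric_space \<Rightarrow> real"
  assumes X: "proper_metric_space TYPE('a)" and h: "slow_map h"
    and nonpos: "\<And>q. q \<in> topspace (higson_corona TYPE('a)) \<Longrightarrow> q h \<le> 0" and "0 < \<epsilon>"
  shows "\<forall>\<^sub>F x in away. h x < \<epsilon>"
proof -
  have slow: "slow_map (\<lambda>x. \<epsilon> - h x)" by (intro slow_map_diff slow_map_const h)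
  show ?thesis
  proof (rule eventually_away_of_corona_pos[OF X slow])
    fix q assume q: "q \<in> topspace (higson_corona TYPE('a))"
    show "0 < q (\<lambda>x. \<epsilon> - h x)"
    proof (rule higson_corona_filter[OF X q])
      fix \<F> :: "'a filter"
      assume \<F>: "\<F> \<noteq> bot" and lim: "\<And>f. slow_map f \<Longrightarrow> (f \<longlongrightarrow> q f) \<F>"
      have "((\<lambda>x. \<epsilon> - h x) \<longlongrightarrow> \<epsilon> - q h) \<F>" by (intro tendsto_intros lim h)
      then have "q (\<lambda>x. \<epsilon> - h x) = \<epsilon> - q h"
        using tendsto_unique[OF \<F> lim[OF slow]] by blast
      then show ?thesis using nonpos[OF q] \<open>0 < \<epsilon>\<close> by simp
    qed
  next
    fix e assume "0 < e" "\<forall>\<^sub>F x in away. e \<le> \<epsilon> - h x"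
    then show ?thesis by (auto elim: eventually_mono)
  qed
qed

lemma slow_map_Min:
  fixes f :: "'i \<Rightarrow> 'a::metric_space \<Rightarrow> real"
  assumes "finite I" "I \<noteq> {}" "\<And>i. i \<in> I \<Longrightarrow> slow_map (f i)"
  shows "slow_map (\<lambda>x. Min ((\<lambda>i. f i x) ` I))"
  using assms by (induction I rule: finite_ne_induct) (simp_all add: slow_map_min)

text \<open>For each of the finitely many index sets of size \<open>m + 1\<close>, the minimum of
  the functions is nonpositive on the corona, hence below \<open>\<eta>\<close> near
  infinity.\<close>

lemma eventually_away_order_le:
  fixes h :: "'i \<Rightarrow> 'a::metric_space \<Rightarrow> real"
  assumes X: "proper_metric_space TYPE('a)" and I: "finite I" and h: "\<And>i. slow_map (h i)"
    and order: "\<And>q. q \<in> topspace (higson_corona TYPE('a)) \<Longrightarrow> card {i\<in>I. 0 < q (h i)} \<le> m"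
    and "0 < \<eta>"
  shows "\<forall>\<^sub>F x in away. card {i\<in>I. \<eta> \<le> h i x} \<le> m"
proof -
  let ?S = "{S. S \<subseteq> I \<and> card S = Suc m}"
  have "\<forall>\<^sub>F x in away. Min ((\<lambda>i. h i x) ` S) < \<eta>" if S: "S \<in> ?S" for S
  proof (rule eventually_away_of_corona_nonpos[OF X _ _ \<open>0 < \<eta>\<close>])
    have fin: "finite S" "S \<noteq> {}" using S I by (auto intro: finite_subset)
    show slow: "slow_map (\<lambda>x. Min ((\<lambda>i. h i x) ` S))"
      by (intro slow_map_Min fin h)
    fix q assume q: "q \<in> topspace (higson_corona TYPE('a))"
    have "\<not> S \<subseteq> {i\<in>I. 0 < q (h i)}"
    proof
      assume "S \<subseteq> {i\<in>I. 0 < q (h i)}"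
      then have "card S \<le> card {i\<in>I. 0 < q (h i)}" using I by (intro card_mono) auto
      then show False using S order[OF q] by simp
    qed
    then obtain i where "i \<in> S" "i \<notin> {i\<in>I. 0 < q (h i)}" by blast
    then have i: "i \<in> S" "q (h i) \<le> 0" using S by auto
    have "q (\<lambda>x. Min ((\<lambda>i. h i x) ` S)) \<le> q (h i)"
      using fin i by (intro higson_corona_mono[OF X q slow h] Min_le) auto
    then show "q (\<lambda>x. Min ((\<lambda>i. h i x) ` S)) \<le> 0" using i by simp
  qed
  then have "\<forall>\<^sub>F x in away. \<forall>S\<in>?S. Min ((\<lambda>i. h i x) ` S) < \<eta>"
    using I by (intro eventually_ball_finite) auto
  then show ?thesis
  proof eventually_elim
    case (elim x)
    show ?case
    proof (rule ccontr)
      assume "\<not> ?thesis"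
      then have "Suc m \<le> card {i\<in>I. \<eta> \<le> h i x}" by simp
      then obtain S where S: "S \<subseteq> {i\<in>I. \<eta> \<le> h i x}" "card S = Suc m" "finite S"
        by (rule obtain_subset_with_card_n)
      then have "S \<noteq> {}" by auto
      then have "\<eta> \<le> Min ((\<lambda>i. h i x) ` S)" using S by (intro Min.boundedI) auto
      moreover have "S \<in> ?S" using S by blast
      ultimately show False using bspec[OF elim] by (simp add: not_le[symmetric])
    qed
  qed
qed

section \<open>General position in Euclidean space\<close>

lemma interior_finite_Union_empty:
  fixes \<C> :: "'a::topological_space set set"
  assumes "finite \<C>" "\<And>C. C \<in> \<C> \<Longrightarrow> closed C" "\<And>C. C \<in> \<C> \<Longrightarrow> interior C = {}"
  shows "interior (\<Union>\<C>) = {}"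
  using assms
proof (induction \<C> rule: finite_induct)
  case (insert C \<C>)
  then show ?case
    using interior_closed_Un_empty_interior[of C "\<Union>\<C>"] by simp
qed simp

text \<open>The hull of at most \<open>DIM('a)\<close> points lies in a proper affine subspace.
  Finitely many such closed sets do not fill a ball, and their union stays a positive distance from
  any point it misses.\<close>

lemma ball_avoiding_convex_hulls:
  fixes z :: "'i \<Rightarrow> 'a::euclidean_space"
  assumes I: "finite I" and "0 < \<delta>"
  obtains p \<eta> where "norm p < \<delta>" "0 < \<eta>"
    "\<And>T y. T \<subseteq> I \<Longrightarrow> card T \<le> DIM('a) \<Longrightarrow> y \<in> convex hull (z ` T) \<Longrightarrow> \<eta> \<le> norm (y - p)"
proof -
  let ?T = "{T. T \<subseteq> I \<and> card T \<le> DIM('a)}"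
  let ?\<C> = "(\<lambda>T. convex hull (z ` T)) ` ?T"
  have fin: "finite ?\<C>" using I by simp
  have T: "closed (convex hull (z ` T))" "interior (convex hull (z ` T)) = {}" if "T \<in> ?T" for T
  proof -
    have "finite T" using that I finite_subset by blast
    then show "closed (convex hull (z ` T))"
      by (intro compact_imp_closed finite_imp_compact_convex_hull) simp
    have "card (z ` T) \<le> DIM('a)"
      using card_image_le[OF \<open>finite T\<close>, of z] that by auto
    then show "interior (convex hull (z ` T)) = {}"
      using \<open>finite T\<close> by (intro empty_interior_convex_hull) auto
  qed
  have "closed (\<Union>?\<C>)" using fin T by (intro closed_Union) auto
  have "interior (\<Union>?\<C>) = {}" using fin T by (intro interior_finite_Union_empty) auto
  then have "\<not> ball 0 \<delta> \<subseteq> \<Union>?\<C>"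
    using interior_maximal[OF _ open_ball, of 0 \<delta>] \<open>0 < \<delta>\<close> centre_in_ball[of "0::'a" \<delta>] by blast
  then obtain p where "p \<in> ball 0 \<delta>" "p \<notin> \<Union>?\<C>" by blast
  then have p: "norm p < \<delta>" "p \<in> - \<Union>?\<C>" by auto
  moreover have "open (- \<Union>?\<C>)" using \<open>closed (\<Union>?\<C>)\<close> by (rule open_Compl)
  ultimately obtain \<eta> where \<eta>: "0 < \<eta>" "ball p \<eta> \<subseteq> - \<Union>?\<C>"
    using open_contains_ball by meson
  show thesis
  proof (rule that[OF p(1) \<eta>(1)])
    fix T y assume "T \<subseteq> I" "card T \<le> DIM('a)" "y \<in> convex hull (z ` T)"
    then have "y \<in> \<Union>?\<C>" by blast
    then have "y \<notin> ball p \<eta>" using \<eta>(2) by blast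
    then show "\<eta> \<le> norm (y - p)" by (simp add: dist_norm norm_minus_commute)
  qed
qed

text \<open>Only indices of positive weight matter. It is used with a simplex, to stay away from
  \<open>p\<close>, and with a ball, to stay near \<open>F x\<close>.\<close>

lemma convex_weighted_mean:
  fixes w :: "'i \<Rightarrow> real" and z :: "'i \<Rightarrow> 'a::real_vector"
  assumes I: "finite I" and w: "\<And>i. i \<in> I \<Longrightarrow> 0 \<le> w i" "0 < (\<Sum>i\<in>I. w i)"
    and C: "convex C" "\<And>i. i \<in> I \<Longrightarrow> 0 < w i \<Longrightarrow> z i \<in> C"
  shows "(\<Sum>i\<in>I. w i *\<^sub>R z i) /\<^sub>R (\<Sum>i\<in>I. w i) \<in> C"
proof -
  let ?T = "{i\<in>I. 0 < w i}" and ?W = "\<Sum>i\<in>I. w i"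
  have out: "w i = 0" if "i \<in> I - ?T" for i
    using that w(1)[of i] by auto
  have "?W = (\<Sum>i\<in>?T. w i)"
    using I out by (intro sum.mono_neutral_right) auto
  then have "(\<Sum>i\<in>?T. w i / ?W) = 1"
    using w(2) by (simp add: sum_divide_distrib[symmetric])
  then have "(\<Sum>i\<in>?T. (w i / ?W) *\<^sub>R z i) \<in> C"
    using I C w(2) by (intro convex_sum) auto
  also have "(\<Sum>i\<in>?T. (w i / ?W) *\<^sub>R z i) = (\<Sum>i\<in>?T. w i *\<^sub>R z i) /\<^sub>R ?W"
    by (simp add: scaleR_sum_right divide_inverse mult.commute)
  also have "(\<Sum>i\<in>?T. w i *\<^sub>R z i) = (\<Sum>i\<in>I. w i *\<^sub>R z i)"
    using I out by (intro sum.mono_neutral_left) auto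
  finally show ?thesis .
qed

text \<open>Averaging the centres of small balls over a cover of order at most \<open>n\<close> approximates \<open>F\<close> by a map
  into a union of \<open>n\<close>-dimensional simplices, which misses a point near the origin.\<close>

lemma covering_dim_le_imp_nonvanishing_approximation:
  fixes F :: "'a::metric_space \<Rightarrow> real^'n::finite"
  assumes X: "proper_metric_space TYPE('a)" and card_n: "CARD('n) = n + 1"
    and dim: "covering_dim_le (higson_corona TYPE('a)) n"
    and F: "slow_map F" and "0 < \<delta>"
  obtains G :: "'a \<Rightarrow> real^'n" and \<eta>
  where "slow_map G" "0 < \<eta>" "\<forall>\<^sub>F x in away. \<eta> \<le> norm (G x) \<and> norm (G x - F x) < 3 * \<delta>"
proof -
  let ?\<nu> = "higson_corona TYPE('a)"
  have "compact (closure (range F))"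
    using slow_map_bounded[OF F] by (simp add: compact_closure)
  then obtain Z where Z: "finite Z" "closure (range F) \<subseteq> (\<Union>z\<in>Z. ball z (\<delta> / 2))"
    using \<open>0 < \<delta>\<close> unfolding compact_eq_totally_bounded by (meson half_gt_zero)
  \<comment> \<open>Centres are \<open>\<delta> / 2\<close>-dense but membership is tested at
    \<open>\<delta>\<close>; the slack keeps the inequality strict in the limit, so the sets
    \<open>U z\<close> cover the corona.\<close>
  define g where "g z x = norm (F x - z) - \<delta>" for z x
  have g: "slow_map (g z)" for z
    unfolding g_def by (intro slow_map_diff slow_map_norm slow_map_const F)
  define U where "U z = {q \<in> topspace ?\<nu>. q (g z) \<in> {..<0}}" for z
  have U: "openin ?\<nu> (U z)" for z
    unfolding U_def by (rule openin_higson_corona_preimage[OF X g]) simp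
  have "q \<in> \<Union> (U ` Z)" if q: "q \<in> topspace ?\<nu>" for q
  proof (rule higson_corona_filter[OF X q])
    fix \<F> :: "'a filter"
    assume \<F>: "\<F> \<noteq> bot" and lim: "\<And>f. slow_map f \<Longrightarrow> (f \<longlongrightarrow> q f) \<F>"
    show ?thesis
    proof (rule ccontr)
      assume "\<not> ?thesis"
      then have "0 \<le> q (g z)" if "z \<in> Z" for z
        using q that by (force simp: U_def)
      then have "\<forall>\<^sub>F x in \<F>. - (\<delta> / 2) < g z x" if "z \<in> Z" for z
        using order_tendstoD(1)[OF lim[OF g[of z]], of "- (\<delta> / 2)"] that \<open>0 < \<delta>\<close> by force
      then have "\<forall>\<^sub>F x in \<F>. \<forall>z\<in>Z. - (\<delta> / 2) < g z x"
        using Z(1) by (intro eventually_ball_finite) auto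
      then obtain x where x: "\<And>z. z \<in> Z \<Longrightarrow> - (\<delta> / 2) < g z x"
        using eventually_happens'[OF \<F>] by blast
      have "F x \<in> closure (range F)" by (meson closure_subset rangeI subsetD)
      then obtain z where "z \<in> Z" "norm (F x - z) < \<delta> / 2"
        using Z(2) by (auto simp: dist_norm norm_minus_commute)
      then show False using x[of z] by (simp add: g_def)
    qed
  qed
  then have "finite (U ` Z) \<and> (\<forall>W\<in>U ` Z. openin ?\<nu> W) \<and> topspace ?\<nu> \<subseteq> \<Union> (U ` Z)"
    using Z(1) U by blast
  from dim[unfolded covering_dim_le_def, rule_format, OF this]
  obtain \<V> where \<V>: "finite \<V>" "\<And>V. V \<in> \<V> \<Longrightarrow> openin ?\<nu> V" "topspace ?\<nu> \<subseteq> \<Union>\<V>"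
    and refine: "\<forall>V\<in>\<V>. \<exists>W\<in>U ` Z. V \<subseteq> W"
    and order: "\<And>q. q \<in> topspace ?\<nu> \<Longrightarrow> card {V\<in>\<V>. q \<in> V} \<le> n + 1"
    by auto
  have "\<forall>V\<in>\<V>. \<exists>z. V \<subseteq> U z" using refine by blast
  from bchoice[OF this] obtain \<zeta> where \<zeta>: "\<And>V. V \<in> \<V> \<Longrightarrow> V \<subseteq> U (\<zeta> V)" by blast
  obtain h :: "_ \<Rightarrow> 'a \<Rightarrow> real" and \<epsilon> where h: "\<And>V. slow_map (h V)"
    and hV: "\<And>V q. q \<in> topspace ?\<nu> \<Longrightarrow> 0 < q (h V) \<Longrightarrow> q \<in> V"
    and \<epsilon>: "0 < \<epsilon>" "\<forall>\<^sub>F x in away. \<epsilon> \<le> (\<Sum>V\<in>\<V>. h V x)"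
    by (rule higson_corona_cover_functions[OF X \<V>(1), of "\<lambda>V. V"]) (use \<V> in auto)
  \<comment> \<open>Lowering every \<open>h V\<close> by \<open>\<eta>\<close> costs at most
    \<open>\<epsilon> / 2\<close> in total; the \<open>+ 1\<close> covers an empty family.\<close>
  define \<eta> where "\<eta> = \<epsilon> / (2 * (real (card \<V>) + 1))"
  have \<eta>: "0 < \<eta>" using \<epsilon>(1) by (simp add: \<eta>_def)
  have \<eta>\<epsilon>: "real (card \<V>) * \<eta> \<le> \<epsilon> / 2" using \<epsilon>(1) by (simp add: \<eta>_def field_simps)
  \<comment> \<open>The order bound on the corona limits only how many \<open>h V\<close> reach
    \<open>\<eta>\<close> near infinity, not how many are positive; truncation leaves at most
    \<open>n + 1\<close> positive weights.\<close>
  define w where "w V x = max 0 (h V x - \<eta>)" for V x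
  have w: "slow_map (w V)" for V
    unfolding w_def by (intro slow_map_max slow_map_diff slow_map_const h)
  have w0: "0 \<le> w V x" for V x by (simp add: w_def)
  have ev_sum: "\<forall>\<^sub>F x in away. \<epsilon> / 2 \<le> (\<Sum>V\<in>\<V>. w V x)"
    using \<epsilon>(2)
  proof eventually_elim
    case (elim x)
    have "(\<Sum>V\<in>\<V>. h V x) - real (card \<V>) * \<eta> = (\<Sum>V\<in>\<V>. h V x - \<eta>)"
      by (simp add: sum_subtractf)
    also have "\<dots> \<le> (\<Sum>V\<in>\<V>. w V x)" by (intro sum_mono) (simp add: w_def)
    finally show ?case using elim \<eta>\<epsilon> by simp
  qed
  have ev_order: "\<forall>\<^sub>F x in away. card {V\<in>\<V>. \<eta> \<le> h V x} \<le> n + 1"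
  proof (rule eventually_away_order_le[OF X \<V>(1) h _ \<eta>])
    fix q assume q: "q \<in> topspace ?\<nu>"
    have "card {V\<in>\<V>. 0 < q (h V)} \<le> card {V\<in>\<V>. q \<in> V}"
      using \<V>(1) hV[OF q] by (intro card_mono) auto
    then show "card {V\<in>\<V>. 0 < q (h V)} \<le> n + 1" using order[OF q] by simp
  qed
  \<comment> \<open>On the corona \<open>h V\<close> and \<open>g (\<zeta> V)\<close> are never both
    positive. Near infinity, \<open>h V x \<ge> \<eta>\<close> thus forces \<open>F x\<close> within
    \<open>2 * \<delta>\<close> of the centre.\<close>
  have "\<forall>\<^sub>F x in away. min (h V x) (g (\<zeta> V) x) < min \<eta> \<delta>" if V: "V \<in> \<V>" for V
  proof (rule eventually_away_of_corona_nonpos[OF X])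
    show slow: "slow_map (\<lambda>x. min (h V x) (g (\<zeta> V) x))" by (intro slow_map_min h g)
    fix q assume q: "q \<in> topspace ?\<nu>"
    show "q (\<lambda>x. min (h V x) (g (\<zeta> V) x)) \<le> 0"
    proof (cases "0 < q (h V)")
      case True
      then have "q (g (\<zeta> V)) < 0" using hV[OF q] \<zeta>[OF V] by (auto simp: U_def)
      then show ?thesis using higson_corona_mono[OF X q slow g[of "\<zeta> V"]] by fastforce
    next
      case False
      then show ?thesis using higson_corona_mono[OF X q slow h[of V]] by fastforce
    qed
  qed (use \<eta> \<open>0 < \<delta>\<close> in simp)
  then have ev_near: "\<forall>\<^sub>F x in away. \<forall>V\<in>\<V>. min (h V x) (g (\<zeta> V) x) < min \<eta> \<delta>"
    using \<V>(1) by (intro eventually_ball_finite) auto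
  obtain p \<theta> where p: "norm p < \<delta>" "0 < \<theta>"
    and \<theta>: "\<And>T y. T \<subseteq> \<V> \<Longrightarrow> card T \<le> DIM(real^'n) \<Longrightarrow> y \<in> convex hull (\<zeta> ` T) \<Longrightarrow> \<theta> \<le> norm (y - p)"
    using ball_avoiding_convex_hulls[OF \<V>(1) \<open>0 < \<delta>\<close>, of \<zeta>] by blast
  define M where "M x = (\<Sum>V\<in>\<V>. w V x *\<^sub>R \<zeta> V) /\<^sub>R max (\<epsilon> / 2) (\<Sum>V\<in>\<V>. w V x)" for x
  have M: "slow_map M"
    unfolding M_def using \<epsilon>(1)
    by (intro slow_map_divide_max slow_map_sum slow_map_scaleR slow_map_const w) simp
  show thesis
  proof (rule that[OF slow_map_diff[OF M slow_map_const[of p]] p(2)])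
    show "\<forall>\<^sub>F x in away. \<theta> \<le> norm (M x - p) \<and> norm (M x - p - F x) < 3 * \<delta>"
      using ev_sum ev_order ev_near
    proof eventually_elim
      case (elim x)
      let ?T = "{V\<in>\<V>. 0 < w V x}"
      have Mx: "M x = (\<Sum>V\<in>\<V>. w V x *\<^sub>R \<zeta> V) /\<^sub>R (\<Sum>V\<in>\<V>. w V x)"
        using elim(1) by (simp add: M_def max_def)
      have pos: "0 < (\<Sum>V\<in>\<V>. w V x)" using elim(1) \<epsilon>(1) by linarith
      have "card ?T \<le> card {V\<in>\<V>. \<eta> \<le> h V x}"
        using \<V>(1) by (intro card_mono) (auto simp: w_def)
      then have "card ?T \<le> DIM(real^'n)" using elim(2) card_n by simp
      moreover have "M x \<in> convex hull (\<zeta> ` ?T)"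
        unfolding Mx by (intro convex_weighted_mean \<V>(1) w0 pos convex_convex_hull hull_inc) auto
      ultimately have "\<theta> \<le> norm (M x - p)" by (intro \<theta>[of ?T]) auto
      moreover have "M x \<in> ball (F x) (2 * \<delta>)"
        unfolding Mx
      proof (intro convex_weighted_mean \<V>(1) w0 pos convex_ball)
        fix V assume "V \<in> \<V>" "0 < w V x"
        then have "g (\<zeta> V) x < \<delta>" using elim(3) by (fastforce simp: w_def)
        then show "\<zeta> V \<in> ball (F x) (2 * \<delta>)" by (simp add: g_def dist_norm)
      qed
      then have "norm (M x - F x) < 2 * \<delta>" by (simp add: dist_norm norm_minus_commute)
      moreover have "norm (M x - p - F x) \<le> norm (M x - F x) + norm p"
        using norm_triangle_ineq4[of "M x - F x" p] by (simp add: algebra_simps)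
      ultimately show ?case using p(1) by simp
    qed
  qed
qed

lemma covering_dim_le_imp_slow_sphere_extension:
  assumes X: "proper_metric_space TYPE('a::metric_space)" and card_n: "CARD('n::finite) = n + 1"
    and dim: "covering_dim_le (higson_corona TYPE('a)) n"
  shows "slow_sphere_extension TYPE('a) TYPE('n)"
  unfolding slow_sphere_extension_def
proof (intro allI impI)
  fix F :: "'a \<Rightarrow> real^'n"
  assume F: "slow_map F"
  obtain G :: "'a \<Rightarrow> real^'n" and \<eta> where G: "slow_map G" and \<eta>: "0 < \<eta>"
    and GF: "\<forall>\<^sub>F x in away. \<eta> \<le> norm (G x) \<and> norm (G x - F x) < 3 * (1 / 8)"
    by (rule covering_dim_le_imp_nonvanishing_approximation[OF X card_n dim F, of "1/8"]) auto
  \<comment> \<open>Interpolates from \<open>G\<close> where \<open>norm (F x) \<le> 1 / 2\<close>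
    to \<open>F\<close> where it is at least 1. Beyond \<open>1 / 2\<close> the error
    \<open>3 / 8\<close> still leaves length \<open>1 / 8\<close>.\<close>
  define t where "t x = min 1 (max 0 (2 * norm (F x) - 1))" for x
  have "slow_map (\<lambda>x. 2 *\<^sub>R norm (F x))"
    by (intro slow_map_scaleR slow_map_const slow_map_norm F)
  then have t: "slow_map t"
    unfolding t_def by (intro slow_map_min slow_map_max slow_map_diff slow_map_const) simp
  define H where "H x = G x + t x *\<^sub>R (F x - G x)" for x
  have H: "slow_map H"
    unfolding H_def by (intro slow_map_add slow_map_scaleR slow_map_diff t F G)
  define c where "c = min \<eta> (1 / 8)"
  have c: "0 < c" using \<eta> by (simp add: c_def)
  have "slow_map (\<lambda>x. H x /\<^sub>R max c (norm (H x)))"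
    by (intro slow_map_divide_max slow_map_norm H c)
  moreover have "\<forall>\<^sub>F x in away. norm (H x /\<^sub>R max c (norm (H x))) = 1 \<and>
      (1 \<le> norm (F x) \<longrightarrow> H x /\<^sub>R max c (norm (H x)) = sgn (F x))"
    using GF
  proof eventually_elim
    case (elim x)
    have c_le: "c \<le> norm (H x)"
    proof (cases "norm (F x) \<le> 1 / 2")
      case True
      then have "H x = G x" by (simp add: H_def t_def)
      then show ?thesis using elim by (simp add: c_def min_le_iff_disj)
    next
      case False
      have "H x - F x = (1 - t x) *\<^sub>R (G x - F x)" by (simp add: H_def algebra_simps)
      moreover have "\<bar>1 - t x\<bar> \<le> 1" by (simp add: t_def)
      ultimately have "norm (H x - F x) \<le> norm (G x - F x)"
        by (simp add: mult_left_le_one_le)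
      then show ?thesis
        using elim False norm_triangle_ineq2[of "F x" "H x"]
        by (simp add: c_def norm_minus_commute min_le_iff_disj)
    qed
    have "norm (H x) \<noteq> 0" using c_le c by linarith
    moreover have "H x = F x" if "1 \<le> norm (F x)"
      using that by (simp add: H_def t_def)
    moreover have "max c (norm (H x)) = norm (H x)" using c_le by simp
    ultimately show ?case
      by (cases "1 \<le> norm (F x)") (auto simp: sgn_div_norm)
  qed
  ultimately show "\<exists>G. slow_map G \<and>
      (\<forall>\<^sub>F x in away. norm (G x) = 1 \<and> (1 \<le> norm (F x) \<longrightarrow> G x = sgn (F x)))"
    by (intro exI[of _ "\<lambda>x. H x /\<^sub>R max c (norm (H x))"] conjI)
qed

section \<open>From sphere-valued maps to covering dimension\<close>

text \<open>The component \<open>F i\<close> is negative near infinity off \<open>U i\<close>; pushing the resulting map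
  to the sphere makes the sets \<open>{G i > 0}\<close> and \<open>T \<inter> {some G i < 0}\<close> a cover without common point.\<close>

lemma slow_sphere_extension_imp_shrinking:
  fixes U :: "'n::finite \<Rightarrow> (('a::metric_space \<Rightarrow> real) \<Rightarrow> real) set"
  assumes X: "proper_metric_space TYPE('a)"
    and ext: "slow_sphere_extension TYPE('a) TYPE('n)"
    and U: "\<And>i. openin (higson_corona TYPE('a)) (U i)" and T: "openin (higson_corona TYPE('a)) T"
    and cover: "topspace (higson_corona TYPE('a)) \<subseteq> (\<Union>i. U i) \<union> T"
  shows "\<exists>W T'. (\<forall>i. openin (higson_corona TYPE('a)) (W i) \<and> W i \<subseteq> U i) \<and>
    openin (higson_corona TYPE('a)) T' \<and> T' \<subseteq> T \<and>
    topspace (higson_corona TYPE('a)) \<subseteq> (\<Union>i. W i) \<union> T' \<and> (\<Inter>i. W i) \<inter> T' = {}"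
proof -
  let ?\<nu> = "higson_corona TYPE('a)"
  \<comment> \<open>\<open>None\<close> indexes the extra set \<open>T\<close>, so \<open>m\<close>
    below is the total number of sets in the cover.\<close>
  define U' where "U' = case_option T U"
  have open_U: "openin ?\<nu> (U' i)" for i by (cases i) (simp_all add: U'_def U T)
  have cover_U: "topspace ?\<nu> \<subseteq> (\<Union>i\<in>UNIV. U' i)"
  proof
    fix q assume "q \<in> topspace ?\<nu>"
    then consider i where "q \<in> U' (Some i)" | "q \<in> U' None" using cover by (auto simp: U'_def)
    then show "q \<in> (\<Union>i\<in>UNIV. U' i)" by cases blast+
  qed
  obtain h :: "'n option \<Rightarrow> 'a \<Rightarrow> real" and \<epsilon>
    where h: "\<And>i. slow_map (h i)" "\<And>i x. 0 \<le> h i x"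
      and hU: "\<And>i q. q \<in> topspace ?\<nu> \<Longrightarrow> 0 < q (h i) \<Longrightarrow> q \<in> U' i"
      and \<epsilon>: "0 < \<epsilon>" "\<forall>\<^sub>F x in away. \<epsilon> \<le> (\<Sum>i\<in>UNIV. h i x)"
    by (rule higson_corona_cover_functions[OF X finite open_U cover_U]) auto
  define m where "m = real CARD('n option)"
  have m: "0 < m" by (simp add: m_def)
  \<comment> \<open>A component is below -1 when \<open>h (Some i) x < \<epsilon> / (4 * m)\<close>
    and at least 2 when \<open>h (Some i) x \<ge> \<epsilon> / m\<close>. In both cases the norm is
    at least 1, so \<open>G\<close> inherits the sign.\<close>
  define F :: "'a \<Rightarrow> real^'n" where "F x = (\<chi> i. (4 * m / \<epsilon>) *\<^sub>R h (Some i) x - 2)" for x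
  have "slow_map (\<lambda>x. (4 * m / \<epsilon>) *\<^sub>R h (Some i) x - 2)" for i
    by (intro slow_map_diff slow_map_scaleR slow_map_const h)
  then have F: "slow_map F"
    by (intro slow_map_vec) (simp add: F_def)
  obtain B where B: "0 < B" "\<And>x. norm (F x) \<le> B"
    using slow_map_normD[OF F] by blast
  obtain G :: "'a \<Rightarrow> real^'n" where G: "slow_map G"
    and GF: "\<forall>\<^sub>F x in away. norm (G x) = 1 \<and> (1 \<le> norm (F x) \<longrightarrow> G x = sgn (F x))"
    using ext F unfolding slow_sphere_extension_def by blast
  let ?G = "\<lambda>i x. G x $ i"
  have Gi: "slow_map (?G i)" for i by (rule slow_map_component[OF G])
  have G_sgn: "G x $ i = F x $ i / norm (F x)"
    if "1 \<le> norm (F x) \<longrightarrow> G x = sgn (F x)" "1 \<le> \<bar>F x $ i\<bar>" for x i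
    using that component_le_norm_cart[of "F x" i] by (simp add: sgn_div_norm divide_inverse mult.commute)
  define W where "W i = {q \<in> topspace ?\<nu>. q (?G i) \<in> {0<..}}" for i
  define N where "N i = {q \<in> topspace ?\<nu>. q (?G i) \<in> {..<0}}" for i
  have W_open: "openin ?\<nu> (W i)" for i
    unfolding W_def by (intro openin_higson_corona_preimage[OF X Gi]) simp
  have N_open: "openin ?\<nu> (N i)" for i
    unfolding N_def by (intro openin_higson_corona_preimage[OF X Gi]) simp
  have W_U: "W i \<subseteq> U i" for i
  proof
    fix q assume "q \<in> W i"
    then have q: "q \<in> topspace ?\<nu>" and pos: "0 < q (?G i)" by (auto simp: W_def)
    show "q \<in> U i"
    proof (rule ccontr, rule higson_corona_filter[OF X q])
      assume "q \<notin> U i"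
      fix \<F> :: "'a filter"
      assume \<F>: "\<F> \<noteq> bot" "\<F> \<le> away" and lim: "\<And>f. slow_map f \<Longrightarrow> (f \<longlongrightarrow> q f) \<F>"
      have "q (h (Some i)) < \<epsilon> / (4 * m)"
      proof -
        have "q (h (Some i)) \<le> 0" using hU[OF q, of "Some i"] \<open>q \<notin> U i\<close> by (force simp: U'_def not_less)
        also have "0 < \<epsilon> / (4 * m)" using \<epsilon>(1) m by simp
        finally show ?thesis .
      qed
      with lim[OF h(1)] have "\<forall>\<^sub>F x in \<F>. h (Some i) x < \<epsilon> / (4 * m)"
        by (rule order_tendstoD)
      with filter_leD[OF \<F>(2) GF] order_tendstoD(1)[OF lim[OF Gi] pos]
      have "\<forall>\<^sub>F x in \<F>. False"
      proof eventually_elim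
        case (elim x)
        have "F x $ i < -1" using elim \<epsilon>(1) m by (simp add: F_def field_simps)
        then have "G x $ i < 0" using G_sgn[of x i] elim by (auto simp: divide_less_0_iff)
        then show ?case using elim by simp
      qed
      then show False using \<F>(1) by simp
    qed
  qed
  have covers: "topspace ?\<nu> \<subseteq> (\<Union>i. W i) \<union> (T \<inter> (\<Union>i. N i))"
  proof
    fix q assume q: "q \<in> topspace ?\<nu>"
    show "q \<in> (\<Union>i. W i) \<union> (T \<inter> (\<Union>i. N i))"
    proof (rule ccontr, rule higson_corona_filter[OF X q])
      assume not_in: "q \<notin> (\<Union>i. W i) \<union> (T \<inter> (\<Union>i. N i))"
      fix \<F> :: "'a filter"
      assume \<F>: "\<F> \<noteq> bot" "\<F> \<le> away" and lim: "\<And>f. slow_map f \<Longrightarrow> (f \<longlongrightarrow> q f) \<F>"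
      have Gi_le: "q (?G i) \<le> 0" for i
        using not_in q by (auto simp: W_def not_less)
      \<comment> \<open>Otherwise every \<open>h i\<close> would fall below
        \<open>\<epsilon> / m\<close> along the filter, contradicting the lower bound
        \<open>\<epsilon>\<close> for the sum of \<open>m\<close> terms.\<close>
      have "q \<in> T"
      proof (rule ccontr)
        assume "q \<notin> T"
        then have "q (h None) \<le> 0" using hU[OF q, of None] by (force simp: U'_def not_less)
        have ev: "\<forall>\<^sub>F x in \<F>. h i x < \<epsilon> / m" for i
        proof (cases i)
          case None
          have "q (h None) < \<epsilon> / m"
            using \<open>q (h None) \<le> 0\<close> \<epsilon>(1) m by (meson divide_pos_pos le_less_trans)
          then show ?thesis using order_tendstoD(2)[OF lim[OF h(1)]] None by blast
        next
          case (Some j)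
          \<comment> \<open>If \<open>F x $ j \<ge> 1\<close>, then \<open>G x $ j\<close> is at
            least \<open>1 / B\<close>, which bounds it away from its nonpositive limit.\<close>
          have "\<forall>\<^sub>F x in \<F>. ?G j x < 1 / B"
            using order_tendstoD(2)[OF lim[OF Gi]] Gi_le[of j] B(1)
            by (meson divide_pos_pos le_less_trans zero_less_one)
          with filter_leD[OF \<F>(2) GF] show ?thesis
          proof eventually_elim
            case (elim x)
            show ?case
            proof (rule ccontr)
              assume "\<not> h i x < \<epsilon> / m"
              then have "4 \<le> 4 * m / \<epsilon> * h i x" using \<epsilon>(1) m by (simp add: field_simps)
              then have "1 \<le> F x $ j" by (simp add: F_def Some)
              moreover from this have "1 \<le> norm (F x)"
                using component_le_norm_cart[of "F x" j] by simp
              ultimately have "1 / B \<le> F x $ j / norm (F x)"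
                using B(2)[of x] by (intro frac_le) auto
              then show False using G_sgn[of x j] \<open>1 \<le> F x $ j\<close> elim by simp
            qed
          qed
        qed
        then have "\<forall>\<^sub>F x in \<F>. \<forall>i\<in>UNIV. h i x < \<epsilon> / m"
          by (intro eventually_ball_finite) auto
        with filter_leD[OF \<F>(2) \<epsilon>(2)] have "\<forall>\<^sub>F x in \<F>. False"
        proof eventually_elim
          case (elim x)
          have "(\<Sum>i\<in>UNIV. h i x) < (\<Sum>i\<in>(UNIV :: 'n option set). \<epsilon> / m)"
            using elim by (intro sum_strict_mono) auto
          also have "\<dots> = \<epsilon>" using m by (simp add: m_def)
          finally show ?case using elim by simp
        qed
        then show False using \<F>(1) by simp
      qed
      \<comment> \<open>A point missed by all these sets would make every coordinate of
        \<open>G\<close> tend to 0, although \<open>G\<close> has norm 1 near infinity.\<close>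
      have "q (?G i) = 0" for i
      proof -
        have "q \<notin> N i" using not_in \<open>q \<in> T\<close> by blast
        then have "\<not> q (?G i) < 0" using q by (simp add: N_def)
        then show ?thesis using Gi_le[of i] by linarith
      qed
      then have "(?G i \<longlongrightarrow> 0) \<F>" for i using lim[OF Gi[of i]] by simp
      then have "(G \<longlongrightarrow> 0) \<F>" by (intro vec_tendstoI) simp
      then have "\<forall>\<^sub>F x in \<F>. norm (G x) < 1"
        using order_tendstoD(2)[OF tendsto_norm, of G 0 \<F> 1] by simp
      with filter_leD[OF \<F>(2) GF] have "\<forall>\<^sub>F x in \<F>. False" by eventually_elim simp
      then show False using \<F>(1) by simp
    qed
  qed
  have "W i \<inter> N i = {}" for i by (auto simp: W_def N_def)
  then have "(\<Inter>i. W i) \<inter> (T \<inter> (\<Union>i. N i)) = {}" by blast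
  moreover have "openin ?\<nu> (T \<inter> (\<Union>i. N i))"
    using N_open T by (intro openin_Int openin_Union) auto
  ultimately show ?thesis
    using W_open W_U covers by (intro exI[of _ W] exI[of _ "T \<inter> (\<Union>i. N i)"]) auto
qed

text \<open>It suffices to shrink covers by \<open>n + 2\<close> sets: for each choice of \<open>n + 2\<close> members of a
  larger cover, merge all other members with one of them, shrink, and separate again.\<close>

lemma covering_dim_leI:
  fixes X :: "'a topology"
  assumes card_n: "CARD('n::finite) = n + 1"
    and shrink: "\<And>(U :: 'n \<Rightarrow> 'a set) T. (\<And>i. openin X (U i)) \<Longrightarrow> openin X T \<Longrightarrow>
      topspace X \<subseteq> (\<Union>i. U i) \<union> T \<Longrightarrow>
      \<exists>W T'. (\<forall>i. openin X (W i) \<and> W i \<subseteq> U i) \<and> openin X T' \<and> T' \<subseteq> T \<and>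
        topspace X \<subseteq> (\<Union>i. W i) \<union> T' \<and> (\<Inter>i. W i) \<inter> T' = {}"
  shows "covering_dim_le X n"
  unfolding covering_dim_le_def
proof (intro allI impI)
  fix \<U> assume \<U>: "finite \<U> \<and> (\<forall>U\<in>\<U>. openin X U) \<and> topspace X \<subseteq> \<Union>\<U>"
  have main: "\<exists>V. (\<forall>U\<in>\<U>. openin X (V U) \<and> V U \<subseteq> U) \<and> topspace X \<subseteq> (\<Union>U\<in>\<U>. V U) \<and>
      (\<forall>S\<in>\<S>. (\<Inter>U\<in>S. V U) = {})"
    if "finite \<S>" "\<S> \<subseteq> {S. S \<subseteq> \<U> \<and> card S = n + 2}" for \<S>
    using that
  proof (induction \<S> rule: finite_induct)
    case empty
    then show ?case using \<U> by (intro exI[of _ "\<lambda>U. U"]) auto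
  next
    case (insert S \<S>)
    have "\<S> \<subseteq> {S. S \<subseteq> \<U> \<and> card S = n + 2}" using insert.prems by blast
    from insert.IH[OF this]
    obtain V where "(\<forall>U\<in>\<U>. openin X (V U) \<and> V U \<subseteq> U) \<and> topspace X \<subseteq> (\<Union>U\<in>\<U>. V U) \<and>
      (\<forall>S\<in>\<S>. (\<Inter>U\<in>S. V U) = {})" ..
    then have V: "\<And>U. U \<in> \<U> \<Longrightarrow> openin X (V U)" "\<And>U. U \<in> \<U> \<Longrightarrow> V U \<subseteq> U"
      and covV: "topspace X \<subseteq> (\<Union>U\<in>\<U>. V U)" and V\<S>: "\<And>S'. S' \<in> \<S> \<Longrightarrow> (\<Inter>U\<in>S'. V U) = {}"
      by blast+
    have S: "S \<subseteq> \<U>" "card S = n + 2" using insert.prems by auto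
    have "finite S" using S \<U> finite_subset by blast
    obtain U0 where U0: "U0 \<in> S" using S(2) by fastforce
    have "card (S - {U0}) = CARD('n)" using S \<open>finite S\<close> U0 card_n by simp
    then obtain b :: "'n \<Rightarrow> 'a set" where b: "bij_betw b UNIV (S - {U0})"
      using \<open>finite S\<close> finite_same_card_bij[of "UNIV :: 'n set" "S - {U0}"] by auto
    have bS: "b i \<in> \<U>" "b i \<in> S - {U0}" for i
      using bij_betwE[OF b] S(1) by auto
    \<comment> \<open>This merges the chosen member \<open>U0\<close> of \<open>S\<close> with all
      members outside \<open>S\<close>.\<close>
    let ?T = "\<Union>U\<in>\<U> - range b. V U"
    have range_b: "range b = S - {U0}" using b by (simp add: bij_betw_def)
    have cov: "topspace X \<subseteq> (\<Union>i. V (b i)) \<union> ?T"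
    proof
      fix x assume "x \<in> topspace X"
      then obtain U where "U \<in> \<U>" "x \<in> V U" using covV by blast
      then show "x \<in> (\<Union>i. V (b i)) \<union> ?T" by (cases "U \<in> range b") auto
    qed
    have "openin X (V (b i))" for i using V(1) bS(1) by blast
    moreover have "openin X ?T" using V(1) by (intro openin_Union) auto
    ultimately have "\<exists>W T'. (\<forall>i. openin X (W i) \<and> W i \<subseteq> V (b i)) \<and> openin X T' \<and> T' \<subseteq> ?T \<and>
        topspace X \<subseteq> (\<Union>i. W i) \<union> T' \<and> (\<Inter>i. W i) \<inter> T' = {}"
      using cov by (rule shrink)
    then obtain W T' where "(\<forall>i. openin X (W i) \<and> W i \<subseteq> V (b i)) \<and> openin X T' \<and> T' \<subseteq> ?T \<and>
        topspace X \<subseteq> (\<Union>i. W i) \<union> T' \<and> (\<Inter>i. W i) \<inter> T' = {}"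
      by (elim exE)
    then have W: "\<And>i. openin X (W i)" "\<And>i. W i \<subseteq> V (b i)"
      and T': "openin X T'" "T' \<subseteq> ?T" and covW: "topspace X \<subseteq> (\<Union>i. W i) \<union> T'"
      and disj: "(\<Inter>i. W i) \<inter> T' = {}"
      by simp_all
    \<comment> \<open>Intersecting each merged member with \<open>T'\<close> separates them again
      without losing any part of \<open>T'\<close>.\<close>
    define V' where "V' U = (if U \<in> range b then W (inv b U) else V U \<inter> T')" for U
    have inj: "inj b" using b by (simp add: bij_betw_def)
    have V'b: "V' (b i) = W i" for i using inj by (simp add: V'_def)
    have V'_else: "V' U = V U \<inter> T'" if "U \<notin> range b" for U using that by (simp add: V'_def)
    have V'_V: "openin X (V' U) \<and> V' U \<subseteq> V U" if "U \<in> \<U>" for U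
    proof (cases "U \<in> range b")
      case True
      then obtain i where "U = b i" by blast
      then show ?thesis using V'b W by simp
    next
      case False
      then show ?thesis using V'_else V(1)[OF that] T'(1) by (simp add: openin_Int)
    qed
    have "topspace X \<subseteq> (\<Union>U\<in>\<U>. V' U)"
    proof
      fix x assume "x \<in> topspace X"
      then consider i where "x \<in> W i" | "x \<in> T'" using covW by blast
      then show "x \<in> (\<Union>U\<in>\<U>. V' U)"
      proof cases
        case 1
        then show ?thesis using V'b bS(1) by blast
      next
        case 2
        then obtain U where "U \<in> \<U> - range b" "x \<in> V U" using T'(2) by blast
        then show ?thesis using V'_else 2 by blast
      qed
    qed
    moreover have "(\<Inter>U\<in>S'. V' U) = {}" if "S' \<in> insert S \<S>" for S'
    proof (cases "S' = S")
      case True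
      have "(\<Inter>U\<in>S. V' U) \<subseteq> W i" for i
        using INF_lower[OF Diff_iff[THEN iffD1, THEN conjunct1, OF bS(2)], of V' i] by (simp add: V'b)
      moreover have "(\<Inter>U\<in>S. V' U) \<subseteq> T'"
        using INF_lower[OF U0, of V'] V'_else[of U0] range_b by auto
      ultimately have "(\<Inter>U\<in>S. V' U) \<subseteq> (\<Inter>i. W i) \<inter> T'"
        by (intro Int_greatest INF_greatest)
      then show ?thesis unfolding disj True by (rule subset_empty[THEN iffD1])
    next
      case False
      then have "S' \<in> \<S>" using that by simp
      moreover have "S' \<subseteq> \<U>" using that insert.prems by auto
      \<comment> \<open>Intersections emptied earlier stay empty, since sets only shrink.\<close>
      then have "(\<Inter>U\<in>S'. V' U) \<subseteq> (\<Inter>U\<in>S'. V U)"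
        by (intro INF_mono) (use V'_V in blast)
      ultimately show ?thesis using V\<S> by simp
    qed
    ultimately show ?case
      using V'_V V(2) by (intro exI[of _ V']) (meson order_trans)
  qed
  have "finite {S. S \<subseteq> \<U> \<and> card S = n + 2}" using \<U> by simp
  from main[OF this subset_refl]
  obtain V where *: "(\<forall>U\<in>\<U>. openin X (V U) \<and> V U \<subseteq> U) \<and> topspace X \<subseteq> (\<Union>U\<in>\<U>. V U) \<and>
      (\<forall>S\<in>{S. S \<subseteq> \<U> \<and> card S = n + 2}. (\<Inter>U\<in>S. V U) = {})" ..
  then have V: "\<And>U. U \<in> \<U> \<Longrightarrow> openin X (V U)" "\<And>U. U \<in> \<U> \<Longrightarrow> V U \<subseteq> U"
    and covV: "topspace X \<subseteq> (\<Union>U\<in>\<U>. V U)" by simp_all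
  have V\<S>: "(\<Inter>U\<in>S. V U) = {}" if "S \<subseteq> \<U>" "card S = n + 2" for S
    using * that by blast
  have "card {Z\<in>V ` \<U>. x \<in> Z} \<le> n + 1" for x
  proof (rule ccontr)
    assume "\<not> ?thesis"
    moreover have "{Z\<in>V ` \<U>. x \<in> Z} = V ` {U\<in>\<U>. x \<in> V U}" by blast
    \<comment> \<open>Different members may shrink to the same set; counting indices bounds the
      number of sets from above.\<close>
    moreover have "card (V ` {U\<in>\<U>. x \<in> V U}) \<le> card {U\<in>\<U>. x \<in> V U}"
      using \<U> by (intro card_image_le) auto
    ultimately have "n + 2 \<le> card {U\<in>\<U>. x \<in> V U}" by simp
    then obtain S where S: "S \<subseteq> {U\<in>\<U>. x \<in> V U}" "card S = n + 2" "finite S"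
      by (rule obtain_subset_with_card_n)
    then have "(\<Inter>U\<in>S. V U) = {}" by (intro V\<S>) auto
    moreover have "x \<in> (\<Inter>U\<in>S. V U)" using S by blast
    ultimately show False by blast
  qed
  then show "\<exists>\<V>. finite \<V> \<and> (\<forall>V\<in>\<V>. openin X V) \<and> topspace X \<subseteq> \<Union>\<V> \<and>
      (\<forall>V\<in>\<V>. \<exists>U\<in>\<U>. V \<subseteq> U) \<and> (\<forall>x\<in>topspace X. card {V\<in>\<V>. x \<in> V} \<le> n + 1)"
    using \<U> V covV by (intro exI[of _ "V ` \<U>"] conjI) (simp_all, blast)
qed

theorem theorem7p6:
  fixes n :: nat
  assumes "proper_metric_space TYPE('a::metric_space)"
    and "CARD('n::finite) = n + 1"
  shows "dimc_le TYPE('a) TYPE('n) \<longleftrightarrow> covering_dim_le (higson_corona TYPE('a)) n"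
proof
  assume "dimc_le TYPE('a) TYPE('n)"
  then have "slow_sphere_extension TYPE('a) TYPE('n)"
    by (rule dimc_le_imp_slow_sphere_extension[OF assms(1)])
  then show "covering_dim_le (higson_corona TYPE('a)) n"
    by (intro covering_dim_leI[OF assms(2)] slow_sphere_extension_imp_shrinking[OF assms(1)])
next
  assume "covering_dim_le (higson_corona TYPE('a)) n"
  then show "dimc_le TYPE('a) TYPE('n)"
    by (rule slow_sphere_extension_imp_dimc_le[OF assms(1)
          covering_dim_le_imp_slow_sphere_extension[OF assms]])
qed

end
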